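(* Under $P$: (i) $E[\sigma_M] = \dfrac{2}{\delta^2}$ and $\mathrm{Var}(\sigma_M) =\dfrac{12}{\delta^4}$; (ii) $\mathrm{Cov}(\sigma_M, M) = \dfrac{2}{\delta^3}$ and the correlation coefficient is $\rho (\sigma_M, M) = \dfrac{1}{\sqrt{3}}$.
   Context: Let $\delta>0$. Under $P$, $\{W_t\}_{t\ge 0}$ is a Brownian motion with $W_0=0$, drift $-\delta/2$ and variance $1$ per unit time. $M=\sup_{0\leq t<\infty}W_t$, and $\sigma_M=\operatorname{argsup}_{0\leq t<\infty}W_t$ is the (a.s. unique) time at which the supremum is attained. $E$, $\mathrm{Var}$, $\mathrm{Cov}$ are taken under $P$, and $\rho(\sigma_M,M)$ denotes the correlation coefficient of $\sigma_M$ and $M$. *)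

theory Defs
  imports "HOL-Probability.Probability"
begin

text \<open>
  Time is modelled by real numbers; only the values \<open>W t\<close> with \<open>t \<ge> 0\<close> are constrained. Every
  sample path, not only almost every one, is required to be continuous, so that path functionals
  such as the overall supremum are random variables without completing \<open>P\<close>. Note that the second
  parameter of \<open>normal_density\<close> is the standard deviation.
\<close>

locale brownian_motion_with_drift = prob_space P
  for P :: "'a measure" and W :: "real \<Rightarrow> 'a \<Rightarrow> real" and \<mu> :: real +
  assumes random_variable_W: "\<And>t. t \<ge> 0 \<Longrightarrow> random_variable borel (W t)"
    and W_0: "\<And>\<omega>. \<omega> \<in> space P \<Longrightarrow> W 0 \<omega> = 0"
    and continuous_paths: "\<And>\<omega>. \<omega> \<in> space P \<Longrightarrow> continuous_on {0..} (\<lambda>t. W t \<omega>)"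
    and normal_increments: "\<And>s t. 0 \<le> s \<Longrightarrow> s < t \<Longrightarrow>
      distributed P lborel (\<lambda>\<omega>. W t \<omega> - W s \<omega>) (normal_density (\<mu> * (t - s)) (sqrt (t - s)))"
    and indep_increments: "\<And>(n::nat) t. 0 \<le> t 0 \<Longrightarrow> (\<And>i. i < n \<Longrightarrow> t i < t (Suc i)) \<Longrightarrow>
      indep_vars (\<lambda>_. borel) (\<lambda>i \<omega>. W (t (Suc i)) \<omega> - W (t i) \<omega>) {..<n}"

definition overall_sup :: "(real \<Rightarrow> 'a \<Rightarrow> real) \<Rightarrow> 'a \<Rightarrow> real" where
  "overall_sup W \<omega> = (SUP t\<in>{0..}. W t \<omega>)"

text \<open>
  The maximiser is only almost surely unique. The infimum selects the first one, which keeps the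
  functional measurable on the exceptional event as well; where the maximiser is unique the choice
  plays no role, as the lemma below shows.
\<close>

definition argsup :: "(real \<Rightarrow> 'a \<Rightarrow> real) \<Rightarrow> 'a \<Rightarrow> real" where
  "argsup W \<omega> = Inf {t. 0 \<le> t \<and> W t \<omega> = overall_sup W \<omega>}"

lemma argsup_eqI:
  assumes "0 \<le> s" and "\<And>t. 0 \<le> t \<Longrightarrow> t \<noteq> s \<Longrightarrow> W t \<omega> < W s \<omega>"
  shows "argsup W \<omega> = s"
proof -
  have "overall_sup W \<omega> = W s \<omega>"
    unfolding overall_sup_def using assms
    by (intro cSup_eq_maximum) (auto intro: less_imp_le dest: assms(2))
  then have "{t. 0 \<le> t \<and> W t \<omega> = overall_sup W \<omega>} = {s}"
    using assms by fastforce
  then show ?thesis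
    by (simp add: argsup_def)
qed

definition (in prob_space) covariance :: "('a \<Rightarrow> real) \<Rightarrow> ('a \<Rightarrow> real) \<Rightarrow> real" where
  "covariance X Y = expectation (\<lambda>\<omega>. (X \<omega> - expectation X) * (Y \<omega> - expectation Y))"

definition (in prob_space) correlation :: "('a \<Rightarrow> real) \<Rightarrow> ('a \<Rightarrow> real) \<Rightarrow> real" where
  "correlation X Y = covariance X Y / (sqrt (variance X) * sqrt (variance Y))"

end

theory Submission
  imports Defs "HOL-Real_Asymp.Real_Asymp"
begin

text \<open>
  Write \<open>M\<close> for the supremum and \<open>\<sigma>\<close> for the first time at which it is attained. All the moments are read
  off the joint Laplace transform
  \<open>E[exp (- a \<sigma> - b M)] = \<delta> / (b + \<theta>)\<close>, where \<open>\<theta> = (\<delta> + sqrt (\<delta>\<^sup>2 + 8 a)) / 2\<close>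
  is the positive root of \<open>\<theta> (\<theta> - \<delta>) / 2 = a\<close>, that is, the rate for which \<open>exp (\<theta> W\<^sub>t - a t)\<close> is a
  martingale (\<open>laplace_argsup_sup\<close>). In the variables \<open>\<delta>\<^sup>2 \<sigma>\<close> and \<open>\<delta> M\<close> the parameter \<open>\<delta>\<close> disappears, and
  the second-order behaviour of the transform at the origin gives means 2 and 1, variances 12 and 1,
  and covariance 2.

  The transform comes from first passages. Let \<open>T\<^sub>x\<close> be the first time at which the path exceeds \<open>x\<close>. For
  \<open>0 \<le> x \<le> y\<close>,
  \<open>E[exp (- a T\<^sub>x); M > y] = exp (- \<theta> x - \<delta> (y - x))\<close> (\<open>expectation_passage\<close>):
  before \<open>T\<^sub>x\<close> one stops the martingale \<open>exp (\<theta> W\<^sub>t - a t)\<close>, afterwards the martingale \<open>exp (\<delta> W\<^sub>t)\<close>.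
  Subtracting two such identities yields \<open>E[exp (- a T\<^sub>x); x < M \<le> x + \<epsilon>]\<close>. On that event
  \<open>T\<^sub>x \<le> \<sigma>\<close>, and \<open>T\<^sub>x\<close> tends to \<open>\<sigma>\<close> as \<open>x\<close> increases to \<open>M\<close>; so summing \<open>exp (- b x)\<close> times these
  expectations over the levels \<open>x = 0, \<epsilon>, 2 \<epsilon>, \<dots>\<close> gives a geometric series whose limit for
  \<open>\<epsilon> \<rightarrow> 0\<close> is the transform (\<open>laplace_on_attained\<close>). Letting \<open>a \<rightarrow> 0\<close> in it shows, as a by-product, that
  the supremum is attained almost surely. Where the maximiser is not unique, the limit
  of the \<open>T\<^sub>x\<close> is the first one, which is also how \<open>argsup\<close> is chosen.

  The passage identity itself is proved on a grid of mesh \<open>h\<close>, where the path is a random walk with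
  normal steps, each independent of the preceding ones. There the two exponentials are no longer exact,
  since the walk overshoots a level when it crosses it. But the
  overshoot of a normal step over any nonnegative level is uniformly small in exponential mean
  (\<open>normal_overshoot_le\<close>), so the value functions become a super- and a submartingale that differ by a
  factor tending to 1 as \<open>h \<rightarrow> 0\<close> (\<open>expectation_grid_passage_bounds\<close>).
\<close>

section \<open>Exponential moments and overshoot of a normal step\<close>

lemma exp_tilt_normal_density:
  fixes \<theta> m s z :: real
  assumes "s > 0"
  shows "normal_density m s z * exp (\<theta> * z) =
    exp (\<theta> * m + \<theta>\<^sup>2 * s\<^sup>2 / 2) * normal_density (m + \<theta> * s\<^sup>2) s z"
proof -
  have "- (z - m)\<^sup>2 / (2 * s\<^sup>2) + \<theta> * z =
      (\<theta> * m + \<theta>\<^sup>2 * s\<^sup>2 / 2) + - (z - (m + \<theta> * s\<^sup>2))\<^sup>2 / (2 * s\<^sup>2)"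
    using assms by (simp add: field_simps power2_eq_square)
  then show ?thesis
    unfolding normal_density_def by (simp add: exp_add[symmetric] mult.assoc)
qed

lemma nn_integral_normal_density_exp:
  fixes \<theta> m s :: real
  assumes "s > 0"
  shows "(\<integral>\<^sup>+z. ennreal (normal_density m s z) * ennreal (exp (\<theta> * z)) \<partial>lborel) =
    ennreal (exp (\<theta> * m + \<theta>\<^sup>2 * s\<^sup>2 / 2))"
proof -
  have "(\<integral>\<^sup>+z. ennreal (normal_density m s z) * ennreal (exp (\<theta> * z)) \<partial>lborel) =
      (\<integral>\<^sup>+z. ennreal (exp (\<theta> * m + \<theta>\<^sup>2 * s\<^sup>2 / 2)) *
        ennreal (normal_density (m + \<theta> * s\<^sup>2) s z) \<partial>lborel)"
    by (intro nn_integral_cong)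
      (simp add: ennreal_mult[symmetric] exp_tilt_normal_density[OF assms])
  also have "\<dots> = ennreal (exp (\<theta> * m + \<theta>\<^sup>2 * s\<^sup>2 / 2)) *
      (\<integral>\<^sup>+z. ennreal (normal_density (m + \<theta> * s\<^sup>2) s z) \<partial>lborel)"
    by (intro nn_integral_cmult) auto
  also have "(\<integral>\<^sup>+z. ennreal (normal_density (m + \<theta> * s\<^sup>2) s z) \<partial>lborel) = 1"
    using assms by (subst nn_integral_eq_integral) auto
  finally show ?thesis by simp
qed

text \<open>
  A bound for \<open>E[exp (\<theta> (\<xi> - r)) | \<xi> > r]\<close> that holds for every level \<open>r \<ge> 0\<close>, where \<open>\<xi>\<close> is normal with
  variance \<open>h\<close> and mean at most 0. The cutoff \<open>\<eta>\<close> is at least \<open>\<theta> h\<close>; the bound is close to 1 if \<open>\<eta>\<close> is small and \<open>h\<close>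
  is much smaller than \<open>\<eta>\<^sup>2\<close>.
\<close>

definition overshoot_factor :: "real \<Rightarrow> real \<Rightarrow> real \<Rightarrow> real" where
  "overshoot_factor \<theta> h \<eta> = exp (\<theta> * \<eta>) * (1 + exp (- \<eta>\<^sup>2 / (2 * h)))"

text \<open>
  Beyond a nonnegative level the normal density decays so fast that moving right by \<open>\<eta>\<close> costs more than
  the factor \<open>exp (\<theta> (z - r))\<close> gains; this is what the condition \<open>\<theta> h \<le> \<eta>\<close> ensures.
\<close>

lemma normal_density_shift_le:
  fixes \<theta> h \<eta> m r z :: real
  assumes "h > 0" "\<eta> > 0" "\<theta> * h \<le> \<eta>" "m \<le> 0" "r \<ge> 0" "r < z"
  shows "normal_density m (sqrt h) (\<eta> + z) * exp (\<theta> * (\<eta> + z - r))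
    \<le> exp (\<theta> * \<eta> - \<eta>\<^sup>2 / (2 * h)) * normal_density m (sqrt h) z"
proof -
  have a: "\<theta> * (z - r) \<le> \<eta> / h * (z - r)"
    using assms by (intro mult_right_mono) (auto simp: field_simps)
  have b: "\<eta> / h * (z - r) \<le> \<eta> / h * (z - m)"
    using assms by (intro mult_left_mono) auto
  have "- (\<eta> + z - m)\<^sup>2 / (2 * h) + \<theta> * (\<eta> + z - r) =
     - (z - m)\<^sup>2 / (2 * h) + (\<theta> * \<eta> - \<eta>\<^sup>2 / (2 * h)) + (\<theta> * (z - r) - \<eta> / h * (z - m))"
    using assms by (simp add: field_simps power2_eq_square)
  then have "- (\<eta> + z - m)\<^sup>2 / (2 * h) + \<theta> * (\<eta> + z - r)
     \<le> (\<theta> * \<eta> - \<eta>\<^sup>2 / (2 * h)) + - (z - m)\<^sup>2 / (2 * h)"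
    using a b by linarith
  then have "exp (- (\<eta> + z - m)\<^sup>2 / (2 * h)) * exp (\<theta> * (\<eta> + z - r))
     \<le> exp (\<theta> * \<eta> - \<eta>\<^sup>2 / (2 * h)) * exp (- (z - m)\<^sup>2 / (2 * h))"
    by (simp only: exp_add[symmetric] exp_le_cancel_iff)
  then have "1 / sqrt (2 * pi * h) * (exp (- (\<eta> + z - m)\<^sup>2 / (2 * h)) * exp (\<theta> * (\<eta> + z - r)))
     \<le> 1 / sqrt (2 * pi * h) * (exp (\<theta> * \<eta> - \<eta>\<^sup>2 / (2 * h)) * exp (- (z - m)\<^sup>2 / (2 * h)))"
    using assms by (intro mult_left_mono) auto
  then show ?thesis
    using assms unfolding normal_density_def by (simp add: mult_ac)
qed

text \<open>
  An overshoot of at most \<open>\<eta>\<close> contributes a factor at most \<open>exp (\<theta> \<eta>)\<close>. A larger one is shifted back by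
  \<open>\<eta>\<close>, which compares it with the total crossing probability at a cost of the second summand of
  \<open>overshoot_factor\<close>.
\<close>

lemma normal_overshoot_le:
  fixes \<theta> h \<eta> m r :: real
  assumes "h > 0" "\<eta> > 0" "0 \<le> \<theta>" "\<theta> * h \<le> \<eta>" "m \<le> 0" "r \<ge> 0"
  defines "f \<equiv> normal_density m (sqrt h)"
  shows "(\<integral>\<^sup>+z. ennreal (f z * exp (\<theta> * (z - r))) * indicator {r<..} z \<partial>lborel)
    \<le> ennreal (overshoot_factor \<theta> h \<eta>) * (\<integral>\<^sup>+z. ennreal (f z) * indicator {r<..} z \<partial>lborel)"
proof -
  have f0: "0 \<le> f z" for z by (simp add: f_def)
  have [measurable]: "f \<in> borel_measurable borel" by (simp add: f_def)
  let ?I = "\<integral>\<^sup>+z. ennreal (f z) * indicator {r<..} z \<partial>lborel"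
  have "(\<integral>\<^sup>+z. ennreal (f z * exp (\<theta> * (z - r))) * indicator {r<..} z \<partial>lborel)
    = (\<integral>\<^sup>+z. ennreal (f z * exp (\<theta> * (z - r))) * indicator {r<..r+\<eta>} z
        + ennreal (f z * exp (\<theta> * (z - r))) * indicator {r+\<eta><..} z \<partial>lborel)"
    using assms(2) by (intro nn_integral_cong) (auto simp: indicator_def)
  also have "\<dots> = (\<integral>\<^sup>+z. ennreal (f z * exp (\<theta> * (z - r))) * indicator {r<..r+\<eta>} z \<partial>lborel)
        + (\<integral>\<^sup>+z. ennreal (f z * exp (\<theta> * (z - r))) * indicator {r+\<eta><..} z \<partial>lborel)"
    by (intro nn_integral_add) auto
  also have "(\<integral>\<^sup>+z. ennreal (f z * exp (\<theta> * (z - r))) * indicator {r<..r+\<eta>} z \<partial>lborel)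
      \<le> (\<integral>\<^sup>+z. ennreal (exp (\<theta> * \<eta>)) * (ennreal (f z) * indicator {r<..} z) \<partial>lborel)"
  proof (intro nn_integral_mono)
    fix z
    have "f z * exp (\<theta> * (z - r)) \<le> exp (\<theta> * \<eta>) * f z" if "z \<le> r + \<eta>"
      using that assms(3) f0[of z]
      by (subst mult.commute, intro mult_right_mono) (auto intro: mult_left_mono)
    then show "ennreal (f z * exp (\<theta> * (z - r))) * indicator {r<..r+\<eta>} z
       \<le> ennreal (exp (\<theta> * \<eta>)) * (ennreal (f z) * indicator {r<..} z)"
      by (auto simp: indicator_def ennreal_mult[symmetric] f0 intro!: ennreal_leI)
  qed
  also have "\<dots> = ennreal (exp (\<theta> * \<eta>)) * ?I"
    by (intro nn_integral_cmult) auto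
  also have "(\<integral>\<^sup>+z. ennreal (f z * exp (\<theta> * (z - r))) * indicator {r+\<eta><..} z \<partial>lborel)
      = (\<integral>\<^sup>+z. ennreal (f (\<eta> + z) * exp (\<theta> * (\<eta> + z - r))) * indicator {r+\<eta><..} (\<eta> + z) \<partial>lborel)"
    by (subst nn_integral_real_affine[where c=1 and t=\<eta>]) auto
  also have "\<dots> \<le> (\<integral>\<^sup>+z. ennreal (exp (\<theta> * \<eta> - \<eta>\<^sup>2 / (2 * h))) * (ennreal (f z) * indicator {r<..} z) \<partial>lborel)"
    using normal_density_shift_le[OF assms(1,2,4,5,6)]
    by (intro nn_integral_mono)
      (auto simp: indicator_def f_def ennreal_mult[symmetric] intro!: ennreal_leI)
  also have "\<dots> = ennreal (exp (\<theta> * \<eta> - \<eta>\<^sup>2 / (2 * h))) * ?I"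
    by (intro nn_integral_cmult) auto
  also have "ennreal (exp (\<theta> * \<eta>)) * ?I + ennreal (exp (\<theta> * \<eta> - \<eta>\<^sup>2 / (2 * h))) * ?I
     = ennreal (exp (\<theta> * \<eta>) + exp (\<theta> * \<eta> - \<eta>\<^sup>2 / (2 * h))) * ?I"
    by (simp add: distrib_right[symmetric])
  also have "exp (\<theta> * \<eta>) + exp (\<theta> * \<eta> - \<eta>\<^sup>2 / (2 * h)) = overshoot_factor \<theta> h \<eta>"
    by (simp add: overshoot_factor_def algebra_simps exp_add[symmetric])
  finally show ?thesis by (simp add: add_left_mono add_right_mono)
qed

lemma overshoot_factor_ge_1:
  assumes "0 \<le> \<theta>" "0 \<le> \<eta>"
  shows "1 \<le> overshoot_factor \<theta> h \<eta>"
  unfolding overshoot_factor_def using assms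
  by (metis add.commute exp_ge_zero le_add_same_cancel1 mult_1 mult_mono one_le_exp_iff mult_nonneg_nonneg zero_le_one)

section \<open>A random walk with its passage time and running maximum\<close>

text \<open>
  A state consists of a clock, the running maximum and the position. The clock advances by the mesh \<open>h\<close>
  only while the running maximum is at most \<open>x\<close>, so after \<open>n\<close> steps it shows \<open>h\<close> times the minimum of \<open>n\<close> and
  the index of the first passage above \<open>x\<close>. With this choice the state is a time-homogeneous Markov chain.
\<close>

definition walk_step :: "real \<Rightarrow> real \<Rightarrow> real \<times> real \<times> real \<Rightarrow> real \<Rightarrow> real \<times> real \<times> real" where
  "walk_step h x = (\<lambda>(\<tau>, m, s) z. (if m \<le> x then \<tau> + h else \<tau>, max m (s + z), s + z))"

primrec walk :: "real \<Rightarrow> real \<Rightarrow> (nat \<Rightarrow> real) \<Rightarrow> nat \<Rightarrow> real \<times> real \<times> real" where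
  "walk h x u 0 = (0, 0, 0)"
| "walk h x u (Suc n) = walk_step h x (walk h x u n) (u n)"

lemma measurable_walk_step [measurable]:
  "case_prod (walk_step h x) \<in>
    (borel \<Otimes>\<^sub>M borel \<Otimes>\<^sub>M borel) \<Otimes>\<^sub>M borel \<rightarrow>\<^sub>M borel \<Otimes>\<^sub>M borel \<Otimes>\<^sub>M borel"
  unfolding walk_step_def case_prod_beta by measurable

text \<open>
  The step sequence is a total function here, but the first \<open>n\<close> states only look at its first \<open>n\<close>
  entries; this puts the state into the \<open>\<sigma>\<close>-algebra of the past.
\<close>

lemma measurable_walk:
  assumes "n \<le> N"
  shows "(\<lambda>u. walk h x u n) \<in> Pi\<^sub>M {..<N} (\<lambda>_. borel) \<rightarrow>\<^sub>M borel \<Otimes>\<^sub>M borel \<Otimes>\<^sub>M borel"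
  using assms
proof (induction n)
  case (Suc n)
  then have [measurable]:
    "(\<lambda>u. walk h x u n) \<in> Pi\<^sub>M {..<N} (\<lambda>_. borel) \<rightarrow>\<^sub>M borel \<Otimes>\<^sub>M borel \<Otimes>\<^sub>M borel"
    by auto
  have [measurable]: "(\<lambda>u. u n) \<in> Pi\<^sub>M {..<N} (\<lambda>_. borel) \<rightarrow>\<^sub>M (borel :: real measure)"
    using Suc.prems by (intro measurable_component_singleton) simp
  have "(\<lambda>u. case_prod (walk_step h x) (walk h x u n, u n))
      \<in> Pi\<^sub>M {..<N} (\<lambda>_. borel) \<rightarrow>\<^sub>M borel \<Otimes>\<^sub>M borel \<Otimes>\<^sub>M borel"
    by measurable
  then show ?case by simp
qed simp

lemma walk_cong: "(\<And>i. i < n \<Longrightarrow> u i = v i) \<Longrightarrow> walk h x u n = walk h x v n"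
  by (induction n) auto

lemma walk_position: "snd (snd (walk h x u n)) = (\<Sum>i<n. u i)"
  by (induction n) (auto simp: walk_step_def split: prod.splits)

lemma walk_position_le_max: "snd (snd (walk h x u n)) \<le> fst (snd (walk h x u n))"
  by (induction n) (auto simp: walk_step_def split: prod.splits)

lemma walk_time_nonneg: "0 \<le> h \<Longrightarrow> 0 \<le> fst (walk h x u n)"
  by (induction n) (auto simp: walk_step_def split: prod.splits)

lemma walk_max_gt_iff:
  assumes "0 \<le> y"
  shows "y < fst (snd (walk h x u n)) \<longleftrightarrow> (\<exists>k\<le>n. y < (\<Sum>i<k. u i))"
proof (induction n)
  case 0
  then show ?case using assms by simp
next
  case (Suc n)
  have "fst (snd (walk h x u (Suc n))) = max (fst (snd (walk h x u n))) (\<Sum>i<Suc n. u i)"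
    using walk_position[of h x u n] by (auto simp: walk_step_def split: prod.splits)
  then show ?case using Suc by (auto simp: le_Suc_eq less_max_iff_disj)
qed

lemma walk_time_eq:
  assumes "0 \<le> x"
  shows "(\<forall>k\<le>n. (\<Sum>i<k. u i) \<le> x) \<and> fst (walk h x u n) = real n * h \<or>
    (\<exists>k\<le>n. fst (walk h x u n) = real k * h \<and> x < (\<Sum>i<k. u i) \<and> (\<forall>j<k. (\<Sum>i<j. u i) \<le> x))"
proof (induction n)
  case 0
  then show ?case using assms by simp
next
  case (Suc n)
  have time: "fst (walk h x u (Suc n)) =
      (if \<exists>k\<le>n. x < (\<Sum>i<k. u i) then fst (walk h x u n) else fst (walk h x u n) + h)"
    using walk_max_gt_iff[OF assms, of h x u n] by (auto simp: walk_step_def split: prod.splits)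
  show ?case
  proof (cases "\<exists>k\<le>n. x < (\<Sum>i<k. u i)")
    case True
    then have "\<exists>k\<le>n. fst (walk h x u n) = real k * h \<and> x < (\<Sum>i<k. u i) \<and> (\<forall>j<k. (\<Sum>i<j. u i) \<le> x)"
      using Suc by force
    then show ?thesis using True time by (auto intro: le_SucI)
  next
    case False
    then have below: "\<forall>k\<le>n. (\<Sum>i<k. u i) \<le> x" by (auto simp: not_less)
    then have "fst (walk h x u n) = real n * h"
      using Suc by (meson leD)
    then have t: "fst (walk h x u (Suc n)) = real (Suc n) * h"
      using False time by (auto simp: algebra_simps)
    show ?thesis
    proof (cases "(\<Sum>i<Suc n. u i) \<le> x")
      case True
      then show ?thesis using below t by (simp add: le_Suc_eq)
    next
      case F: False
      have "\<forall>j<Suc n. (\<Sum>i<j. u i) \<le> x" using below by auto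
      then show ?thesis using t F by (intro disjI2 exI[of _ "Suc n"]) auto
    qed
  qed
qed

section \<open>A value function for the passage of two levels\<close>

text \<open>
  For \<open>c = 1\<close> this is the conditional expectation of \<open>exp (- a T\<^sub>x)\<close> on the event that level \<open>y\<close> is
  exceeded, given the present state, as it would be if levels were hit exactly. Each level still to
  be crossed contributes one factor \<open>c\<close>, which makes room for the overshoot.
\<close>

definition passage_value ::
  "real \<Rightarrow> real \<Rightarrow> real \<Rightarrow> real \<Rightarrow> real \<Rightarrow> real \<Rightarrow> real \<times> real \<times> real \<Rightarrow> real" where
  "passage_value a \<theta> \<delta> x y c = (\<lambda>(\<tau>, m, s). exp (- a * \<tau>) *
    (if y < m then 1
     else if x < m then c * exp (- \<delta> * (y - s))
     else c\<^sup>2 * exp (- \<theta> * (x - s) - \<delta> * (y - x))))"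

lemma measurable_passage_value [measurable]:
  "passage_value a \<theta> \<delta> x y c \<in> borel_measurable (borel \<Otimes>\<^sub>M borel \<Otimes>\<^sub>M borel)"
  unfolding passage_value_def case_prod_beta by measurable

lemma passage_value_nonneg: "0 \<le> c \<Longrightarrow> 0 \<le> passage_value a \<theta> \<delta> x y c q"
  by (auto simp: passage_value_def split: prod.splits)

text \<open>
  The left-hand side is \<open>c\<close> times the full exponential moment \<open>E[exp (\<kappa> (\<xi> - r))]\<close>. On the crossing event
  the exponential is replaced by 1; the overshoot bound says that \<open>c\<close> pays for this. The bound is used for
  the two rates \<open>\<kappa> = \<delta>\<close> and \<open>\<kappa> = \<theta>\<close>, with the overshoot factor of the larger one.
\<close>

lemma normal_passage_ge:
  fixes \<theta> \<kappa> h \<eta> m r c :: real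
  assumes "h > 0" "\<eta> > 0" "0 \<le> \<kappa>" "\<kappa> \<le> \<theta>" "\<theta> * h \<le> \<eta>" "m \<le> 0" "r \<ge> 0"
    and c: "0 \<le> c" "c * overshoot_factor \<theta> h \<eta> \<le> 1"
  defines "f \<equiv> normal_density m (sqrt h)"
  shows "ennreal (c * exp (- \<kappa> * r + \<kappa> * m + \<kappa>\<^sup>2 * h / 2))
    \<le> (\<integral>\<^sup>+z. ennreal (f z * (if r < z then 1 else c * exp (\<kappa> * (z - r)))) \<partial>lborel)"
proof -
  have f0: "0 \<le> f z" for z by (simp add: f_def)
  have [measurable]: "f \<in> borel_measurable borel" by (simp add: f_def)
  have "ennreal (c * exp (- \<kappa> * r + \<kappa> * m + \<kappa>\<^sup>2 * h / 2))
      = ennreal (c * exp (- \<kappa> * r)) * (\<integral>\<^sup>+z. ennreal (f z) * ennreal (exp (\<kappa> * z)) \<partial>lborel)"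
    using assms(1) c(1) unfolding f_def
    by (subst nn_integral_normal_density_exp) (auto simp: ennreal_mult[symmetric] exp_add[symmetric])
  also have "\<dots> = (\<integral>\<^sup>+z. ennreal (c * exp (- \<kappa> * r)) * (ennreal (f z) * ennreal (exp (\<kappa> * z))) \<partial>lborel)"
    by (intro nn_integral_cmult[symmetric]) auto
  also have "\<dots> = (\<integral>\<^sup>+z. ennreal (f z * (c * exp (\<kappa> * (z - r)))) \<partial>lborel)"
    using c(1) f0
    by (intro nn_integral_cong) (simp add: ennreal_mult[symmetric] algebra_simps exp_diff exp_minus divide_inverse)
  also have "\<dots> \<le> (\<integral>\<^sup>+z. ennreal c * (ennreal (f z * exp (\<theta> * (z - r))) * indicator {r<..} z)
        + ennreal (f z * (c * exp (\<kappa> * (z - r)))) * indicator {..r} z \<partial>lborel)"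
  proof (intro nn_integral_mono)
    fix z
    have "f z * (c * exp (\<kappa> * (z - r))) \<le> c * (f z * exp (\<theta> * (z - r)))" if "r < z"
    proof -
      have "exp (\<kappa> * (z - r)) \<le> exp (\<theta> * (z - r))" using that assms(4) by (simp add: mult_right_mono)
      then have "(f z * c) * exp (\<kappa> * (z - r)) \<le> (f z * c) * exp (\<theta> * (z - r))"
        using f0[of z] c(1) by (intro mult_left_mono) auto
      then show ?thesis by (simp add: mult_ac)
    qed
    then show "ennreal (f z * (c * exp (\<kappa> * (z - r))))
      \<le> ennreal c * (ennreal (f z * exp (\<theta> * (z - r))) * indicator {r<..} z)
        + ennreal (f z * (c * exp (\<kappa> * (z - r)))) * indicator {..r} z"
      using c(1) f0 by (auto simp: indicator_def ennreal_mult[symmetric] intro!: ennreal_leI)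
  qed
  also have "\<dots> = ennreal c * (\<integral>\<^sup>+z. ennreal (f z * exp (\<theta> * (z - r))) * indicator {r<..} z \<partial>lborel)
        + (\<integral>\<^sup>+z. ennreal (f z * (c * exp (\<kappa> * (z - r)))) * indicator {..r} z \<partial>lborel)"
    by (subst nn_integral_add) (auto simp: nn_integral_cmult)
  also have "ennreal c * (\<integral>\<^sup>+z. ennreal (f z * exp (\<theta> * (z - r))) * indicator {r<..} z \<partial>lborel)
      \<le> (\<integral>\<^sup>+z. ennreal (f z) * indicator {r<..} z \<partial>lborel)" (is "_ \<le> ?I")
  proof -
    have "ennreal c * (\<integral>\<^sup>+z. ennreal (f z * exp (\<theta> * (z - r))) * indicator {r<..} z \<partial>lborel)
        \<le> ennreal c * (ennreal (overshoot_factor \<theta> h \<eta>) * ?I)"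
      unfolding f_def using assms by (intro mult_left_mono normal_overshoot_le) auto
    also have "\<dots> = ennreal (c * overshoot_factor \<theta> h \<eta>) * ?I"
      using c(1) by (simp add: ennreal_mult' mult.assoc)
    also have "\<dots> \<le> 1 * ?I"
      using c(2) by (intro mult_right_mono) auto
    finally show ?thesis by simp
  qed
  also have "?I + (\<integral>\<^sup>+z. ennreal (f z * (c * exp (\<kappa> * (z - r)))) * indicator {..r} z \<partial>lborel)
    = (\<integral>\<^sup>+z. ennreal (f z) * indicator {r<..} z
        + ennreal (f z * (c * exp (\<kappa> * (z - r)))) * indicator {..r} z \<partial>lborel)"
    by (intro nn_integral_add[symmetric]) auto
  also have "\<dots> = (\<integral>\<^sup>+z. ennreal (f z * (if r < z then 1 else c * exp (\<kappa> * (z - r)))) \<partial>lborel)"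
    by (intro nn_integral_cong) (auto simp: indicator_def)
  finally show ?thesis by (simp add: add_right_mono)
qed

text \<open>
  Submartingale property. With only level \<open>y\<close> left, the rate \<open>\<delta>\<close> makes \<open>E[exp (\<delta> \<xi>)] = 1\<close>; with both levels
  left, the rate \<open>\<theta>\<close> makes \<open>E[exp (\<theta> \<xi>)] = exp (a h)\<close>, which offsets the discounting over one step.
\<close>

lemma passage_value_step_ge:
  fixes a \<theta> \<delta> x y c h \<eta> \<tau> m s :: real
  assumes "\<delta> > 0" "\<delta> \<le> \<theta>" "a = \<theta> * (\<theta> - \<delta>) / 2" "h > 0" "\<eta> > 0" "\<theta> * h \<le> \<eta>"
    and c: "0 \<le> c" "c * overshoot_factor \<theta> h \<eta> \<le> 1"
    and "x \<le> y" "s \<le> m"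
  defines "f \<equiv> normal_density (- \<delta> / 2 * h) (sqrt h)"
  shows "ennreal (passage_value a \<theta> \<delta> x y c (\<tau>, m, s))
    \<le> (\<integral>\<^sup>+z. ennreal (f z) * ennreal (passage_value a \<theta> \<delta> x y c (walk_step h x (\<tau>, m, s) z)) \<partial>lborel)"
    (is "?L \<le> ?R")
proof -
  have f0: "0 \<le> f z" for z by (simp add: f_def)
  have [measurable]: "f \<in> borel_measurable borel" by (simp add: f_def)
  have c1: "c \<le> 1"
    using c overshoot_factor_ge_1[of \<theta> \<eta> h] assms(1,2,5) mult_left_mono[of 1 "overshoot_factor \<theta> h \<eta>" c]
    by simp
  have key: "ennreal (K * (c * exp (- \<kappa> * r + \<kappa> * (- \<delta> / 2 * h) + \<kappa>\<^sup>2 * h / 2))) \<le> ?R"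
    if "0 \<le> \<kappa>" "\<kappa> \<le> \<theta>" "0 \<le> r" "0 \<le> K"
      and le: "\<And>z. K * (if r < z then 1 else c * exp (\<kappa> * (z - r)))
        \<le> passage_value a \<theta> \<delta> x y c (walk_step h x (\<tau>, m, s) z)" for \<kappa> r K
  proof -
    have "ennreal (K * (c * exp (- \<kappa> * r + \<kappa> * (- \<delta> / 2 * h) + \<kappa>\<^sup>2 * h / 2)))
      \<le> ennreal K * (\<integral>\<^sup>+z. ennreal (f z * (if r < z then 1 else c * exp (\<kappa> * (z - r)))) \<partial>lborel)"
      using that assms normal_passage_ge[of h \<eta> \<kappa> \<theta> "- \<delta> / 2 * h" r c]
      by (subst ennreal_mult) (auto simp: f_def intro!: mult_left_mono)
    also have "\<dots> = (\<integral>\<^sup>+z. ennreal K * ennreal (f z * (if r < z then 1 else c * exp (\<kappa> * (z - r)))) \<partial>lborel)"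
      by (intro nn_integral_cmult[symmetric]) auto
    also have "\<dots> \<le> ?R"
    proof (intro nn_integral_mono)
      fix z
      have "f z * (K * (if r < z then 1 else c * exp (\<kappa> * (z - r))))
         \<le> f z * passage_value a \<theta> \<delta> x y c (walk_step h x (\<tau>, m, s) z)"
        by (intro mult_left_mono le f0)
      then show "ennreal K * ennreal (f z * (if r < z then 1 else c * exp (\<kappa> * (z - r))))
         \<le> ennreal (f z) * ennreal (passage_value a \<theta> \<delta> x y c (walk_step h x (\<tau>, m, s) z))"
        using \<open>0 \<le> K\<close> c(1) f0[of z] passage_value_nonneg[OF c(1)]
        by (simp add: ennreal_mult'[symmetric] ennreal_mult''[symmetric] ennreal_leI mult.left_commute)
    qed
    finally show ?thesis .
  qed
  consider "y < m" | "m \<le> y" "x < m" | "m \<le> x" by linarith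
  then show ?thesis
  proof cases
    case 1
    then have "?R = (\<integral>\<^sup>+z. ennreal (exp (- a * \<tau>)) * ennreal (f z) \<partial>lborel)"
      using \<open>x \<le> y\<close> by (intro nn_integral_cong) (auto simp: passage_value_def walk_step_def mult.commute)
    also have "\<dots> = ennreal (exp (- a * \<tau>)) * (\<integral>\<^sup>+z. ennreal (f z) \<partial>lborel)"
      by (intro nn_integral_cmult) auto
    also have "(\<integral>\<^sup>+z. ennreal (f z) \<partial>lborel) = 1"
      unfolding f_def using assms(4) by (subst nn_integral_eq_integral) auto
    finally show ?thesis using 1 by (simp add: passage_value_def)
  next
    case 2
    have "K * (c * exp (- \<delta> * (y - s) + \<delta> * (- \<delta> / 2 * h) + \<delta>\<^sup>2 * h / 2)) =
       passage_value a \<theta> \<delta> x y c (\<tau>, m, s)" if "K = exp (- a * \<tau>)" for K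
      using 2 that by (simp add: passage_value_def power2_eq_square)
    moreover have "ennreal (exp (- a * \<tau>) * (c * exp (- \<delta> * (y - s) + \<delta> * (- \<delta> / 2 * h) + \<delta>\<^sup>2 * h / 2))) \<le> ?R"
    proof (rule key)
      fix z
      show "exp (- a * \<tau>) * (if y - s < z then 1 else c * exp (\<delta> * (z - (y - s))))
        \<le> passage_value a \<theta> \<delta> x y c (walk_step h x (\<tau>, m, s) z)"
        using 2 by (auto simp: passage_value_def walk_step_def algebra_simps)
    qed (use assms 2 in auto)
    ultimately show ?thesis by metis
  next
    case 3
    \<comment> \<open>A step above \<open>x\<close>, even one that jumps over \<open>y\<close> as well, is worth at least \<open>?K\<close>, its value exactly at \<open>x\<close>.\<close>
    let ?K = "exp (- a * (\<tau> + h)) * c * exp (- \<delta> * (y - x))"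
    have "\<theta> * (- \<delta> / 2 * h) + \<theta>\<^sup>2 * h / 2 = a * h"
      unfolding assms(3) by (simp add: power2_eq_square field_simps)
    then have "?K * (c * exp (- \<theta> * (x - s) + \<theta> * (- \<delta> / 2 * h) + \<theta>\<^sup>2 * h / 2)) =
       ?K * (c * exp (- \<theta> * (x - s) + a * h))"
      by (simp add: add.assoc)
    also have "\<dots> = passage_value a \<theta> \<delta> x y c (\<tau>, m, s)"
      using 3 \<open>x \<le> y\<close>
      by (simp add: passage_value_def power2_eq_square mult_ac exp_add[symmetric] algebra_simps)
    finally have "passage_value a \<theta> \<delta> x y c (\<tau>, m, s) =
      ?K * (c * exp (- \<theta> * (x - s) + \<theta> * (- \<delta> / 2 * h) + \<theta>\<^sup>2 * h / 2))" by simp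
    moreover have "ennreal (?K * (c * exp (- \<theta> * (x - s) + \<theta> * (- \<delta> / 2 * h) + \<theta>\<^sup>2 * h / 2))) \<le> ?R"
    proof (rule key)
      fix z
      consider "z \<le> x - s" | "x - s < z" "z \<le> y - s" | "y - s < z" by linarith
      then show "?K * (if x - s < z then 1 else c * exp (\<theta> * (z - (x - s))))
        \<le> passage_value a \<theta> \<delta> x y c (walk_step h x (\<tau>, m, s) z)"
      proof cases
        case 1
        then show ?thesis using 3 \<open>x \<le> y\<close>
          by (auto simp: passage_value_def walk_step_def power2_eq_square mult_ac exp_add[symmetric] algebra_simps)
      next
        case 2
        have "exp (- \<delta> * (y - x)) \<le> exp (- \<delta> * (y - (s + z)))"
          using 2 assms(1) by (simp add: mult_left_mono)
        then have "exp (- a * (\<tau> + h)) * (c * exp (- \<delta> * (y - x)))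
            \<le> exp (- a * (\<tau> + h)) * (c * exp (- \<delta> * (y - (s + z))))"
          using c(1) by (intro mult_left_mono) auto
        then show ?thesis using 2 3 \<open>x \<le> y\<close>
          by (auto simp: passage_value_def walk_step_def mult_ac)
      next
        case c3: 3
        have "c * exp (- \<delta> * (y - x)) \<le> 1"
          using c(1) c1 \<open>x \<le> y\<close> assms(1) by (intro mult_le_one) auto
        then have "exp (- a * (\<tau> + h)) * (c * exp (- \<delta> * (y - x))) \<le> exp (- a * (\<tau> + h)) * 1"
          by (intro mult_left_mono) auto
        then show ?thesis using c3 3 \<open>x \<le> y\<close>
          by (auto simp: passage_value_def walk_step_def mult_ac)
      qed
    qed (use assms 3 in auto)
    ultimately show ?thesis by metis
  qed
qed

text \<open>
  Supermartingale property. Without the factors \<open>c\<close>, extending the exponential above a level only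
  overestimates the value there, and extending at the rate \<open>\<theta>\<close> dominates extending at the rate \<open>\<delta>\<close>.
\<close>

lemma passage_value_step_le:
  fixes a \<theta> \<delta> x y h \<tau> m s :: real
  assumes "\<delta> > 0" "\<delta> \<le> \<theta>" "a = \<theta> * (\<theta> - \<delta>) / 2" "h > 0" "x \<le> y" "s \<le> m"
  defines "f \<equiv> normal_density (- \<delta> / 2 * h) (sqrt h)"
  shows "(\<integral>\<^sup>+z. ennreal (f z) * ennreal (passage_value a \<theta> \<delta> x y 1 (walk_step h x (\<tau>, m, s) z)) \<partial>lborel)
    \<le> ennreal (passage_value a \<theta> \<delta> x y 1 (\<tau>, m, s))"
    (is "?R \<le> ?L")
proof -
  have f0: "0 \<le> f z" for z by (simp add: f_def)
  have [measurable]: "f \<in> borel_measurable borel" by (simp add: f_def)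
  have key: "?R \<le> ennreal (K * exp (\<kappa> * (- \<delta> / 2 * h) + \<kappa>\<^sup>2 * h / 2))"
    if "0 \<le> K" and le: "\<And>z. passage_value a \<theta> \<delta> x y 1 (walk_step h x (\<tau>, m, s) z) \<le> K * exp (\<kappa> * z)"
    for \<kappa> K
  proof -
    have "?R \<le> (\<integral>\<^sup>+z. ennreal K * (ennreal (f z) * ennreal (exp (\<kappa> * z))) \<partial>lborel)"
    proof (intro nn_integral_mono)
      fix z
      have "ennreal (f z) * ennreal (passage_value a \<theta> \<delta> x y 1 (walk_step h x (\<tau>, m, s) z))
        \<le> ennreal (f z) * ennreal (K * exp (\<kappa> * z))"
        by (intro mult_left_mono ennreal_leI le) auto
      then show "ennreal (f z) * ennreal (passage_value a \<theta> \<delta> x y 1 (walk_step h x (\<tau>, m, s) z))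
        \<le> ennreal K * (ennreal (f z) * ennreal (exp (\<kappa> * z)))"
        using that(1) by (simp add: ennreal_mult' mult.left_commute)
    qed
    also have "\<dots> = ennreal K * (\<integral>\<^sup>+z. ennreal (f z) * ennreal (exp (\<kappa> * z)) \<partial>lborel)"
      by (intro nn_integral_cmult) auto
    also have "\<dots> = ennreal (K * exp (\<kappa> * (- \<delta> / 2 * h) + \<kappa>\<^sup>2 * h / 2))"
      unfolding f_def using assms(4) that(1)
      by (subst nn_integral_normal_density_exp) (auto simp: ennreal_mult)
    finally show ?thesis .
  qed
  consider "y < m" | "m \<le> y" "x < m" | "m \<le> x" by linarith
  then show ?thesis
  proof cases
    case 1
    have "?R \<le> ennreal (exp (- a * \<tau>) * exp (0 * (- \<delta> / 2 * h) + 0\<^sup>2 * h / 2))"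
      using 1 \<open>x \<le> y\<close> by (intro key) (auto simp: passage_value_def walk_step_def)
    then show ?thesis using 1 by (simp add: passage_value_def)
  next
    case 2
    have "?R \<le> ennreal ((exp (- a * \<tau>) * exp (- \<delta> * (y - s))) * exp (\<delta> * (- \<delta> / 2 * h) + \<delta>\<^sup>2 * h / 2))"
    proof (rule key)
      fix z
      have "1 \<le> exp (- \<delta> * (y - s)) * exp (\<delta> * z)" if "y < s + z"
      proof -
        have "0 \<le> \<delta> * (s + z - y)" using that assms(1) by simp
        then show ?thesis by (simp add: exp_add[symmetric] algebra_simps)
      qed
      then show "passage_value a \<theta> \<delta> x y 1 (walk_step h x (\<tau>, m, s) z)
        \<le> (exp (- a * \<tau>) * exp (- \<delta> * (y - s))) * exp (\<delta> * z)"
        using 2 by (auto simp: passage_value_def walk_step_def mult.assoc exp_add[symmetric] algebra_simps)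
    qed auto
    then show ?thesis using 2 by (simp add: passage_value_def power2_eq_square)
  next
    case 3
    let ?K = "exp (- a * (\<tau> + h)) * exp (- \<theta> * (x - s) - \<delta> * (y - x))"
    have "?R \<le> ennreal (?K * exp (\<theta> * (- \<delta> / 2 * h) + \<theta>\<^sup>2 * h / 2))"
    proof (rule key)
      fix z
      consider "z \<le> x - s" | "x - s < z" "z \<le> y - s" | "y - s < z" by linarith
      then show "passage_value a \<theta> \<delta> x y 1 (walk_step h x (\<tau>, m, s) z) \<le> ?K * exp (\<theta> * z)"
      proof cases
        case 1
        then show ?thesis using 3 \<open>x \<le> y\<close>
          by (auto simp: passage_value_def walk_step_def mult_ac exp_add[symmetric] algebra_simps)
      next
        case 2
        have "\<delta> * (s + z - x) \<le> \<theta> * (s + z - x)"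
          using 2 assms(2) by (intro mult_right_mono) auto
        then have "exp (- \<delta> * (y - (s + z))) \<le> exp (- \<theta> * (x - s) - \<delta> * (y - x)) * exp (\<theta> * z)"
          by (simp add: exp_add[symmetric] algebra_simps)
        then have "exp (- a * (\<tau> + h)) * exp (- \<delta> * (y - (s + z)))
          \<le> exp (- a * (\<tau> + h)) * (exp (- \<theta> * (x - s) - \<delta> * (y - x)) * exp (\<theta> * z))"
          by (intro mult_left_mono) auto
        then show ?thesis using 2 3 \<open>x \<le> y\<close>
          by (auto simp: passage_value_def walk_step_def mult.assoc)
      next
        case c3: 3
        have "\<delta> * (s + z - x) \<le> \<theta> * (s + z - x)"
          using c3 assms(2,5) by (intro mult_right_mono) auto
        moreover have "\<delta> * (y - x) \<le> \<delta> * (s + z - x)"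
          using c3 assms(1) by (intro mult_left_mono) auto
        ultimately have "1 \<le> exp (- \<theta> * (x - s) - \<delta> * (y - x)) * exp (\<theta> * z)"
          by (simp add: exp_add[symmetric] algebra_simps)
        then have "exp (- a * (\<tau> + h)) * 1
          \<le> exp (- a * (\<tau> + h)) * (exp (- \<theta> * (x - s) - \<delta> * (y - x)) * exp (\<theta> * z))"
          by (intro mult_left_mono) auto
        then show ?thesis using c3 3 \<open>x \<le> y\<close>
          by (auto simp: passage_value_def walk_step_def mult.assoc)
      qed
    qed auto
    also have "\<theta> * (- \<delta> / 2 * h) + \<theta>\<^sup>2 * h / 2 = a * h"
      unfolding assms(3) by (simp add: power2_eq_square field_simps)
    also have "?K * exp (a * h) = passage_value a \<theta> \<delta> x y 1 (\<tau>, m, s)"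
      using 3 \<open>x \<le> y\<close> by (simp add: passage_value_def exp_add[symmetric] algebra_simps)
    finally show ?thesis .
  qed
qed

text \<open>
  The value of a state in which \<open>y\<close> has not been exceeded is bounded by an exponential in the position at
  half the rate \<open>\<delta>\<close>, for which the expectation decays in time (see \<open>nn_integral_exp_W\<close> with
  \<open>\<kappa> = \<delta> / 2\<close>). So nothing is lost at infinity, even for \<open>a = 0\<close>.
\<close>

lemma passage_value_residual:
  assumes "\<delta> > 0" "\<delta> \<le> \<theta>" "0 \<le> a" "0 \<le> c" "c \<le> 1" "x \<le> y" "s \<le> m" "0 \<le> \<tau>"
  shows "passage_value a \<theta> \<delta> x y c (\<tau>, m, s)
    \<le> (if y < m then exp (- a * \<tau>) else 0) + exp (- \<delta> / 2 * (y - s))"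
proof -
  have e1: "exp (- a * \<tau>) \<le> 1" using assms by simp
  have c2: "c\<^sup>2 \<le> 1" using assms by (simp add: power_le_one)
  consider "y < m" | "m \<le> y" "x < m" | "m \<le> x" by linarith
  then show ?thesis
  proof cases
    case 2
    have "exp (- \<delta> * (y - s)) \<le> exp (- \<delta> / 2 * (y - s))"
      using 2 assms by (simp add: mult_right_mono)
    then have "exp (- a * \<tau>) * (c * exp (- \<delta> * (y - s))) \<le> 1 * (1 * exp (- \<delta> / 2 * (y - s)))"
      using e1 assms by (intro mult_mono) auto
    then show ?thesis using 2 by (simp add: passage_value_def)
  next
    case 3
    have "\<delta> / 2 * (x - s) \<le> \<theta> * (x - s)" "\<delta> / 2 * (y - x) \<le> \<delta> * (y - x)"
      using 3 assms by (intro mult_right_mono; simp)+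
    then have "exp (- \<theta> * (x - s) - \<delta> * (y - x)) \<le> exp (- \<delta> / 2 * (y - s))"
      by (simp add: algebra_simps diff_divide_distrib add_divide_distrib)
    then have "exp (- a * \<tau>) * (c\<^sup>2 * exp (- \<theta> * (x - s) - \<delta> * (y - x))) \<le> 1 * (1 * exp (- \<delta> / 2 * (y - s)))"
      using e1 c2 by (intro mult_mono) auto
    then show ?thesis using 3 \<open>x \<le> y\<close> by (simp add: passage_value_def)
  qed (simp add: passage_value_def)
qed

section \<open>The walk on a grid of Brownian times\<close>

text \<open>
  Integrating out the next step for a fixed past. The past is a tuple and the next step is a number,
  whereas the independence of two random variables is expressed for a common type; hence the step is
  first viewed as a one-element tuple.
\<close>

lemma (in prob_space) nn_integral_past_and_next:
  fixes \<xi> :: "nat \<Rightarrow> 'a \<Rightarrow> real" and f :: "real \<Rightarrow> real"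
  assumes ind: "indep_vars (\<lambda>_. borel) \<xi> {..<Suc n}"
    and dens: "distributed M lborel (\<xi> n) f"
    and \<phi>: "\<phi> \<in> Pi\<^sub>M {..<n} (\<lambda>_. borel) \<rightarrow>\<^sub>M N"
    and g [measurable]: "g \<in> borel_measurable (N \<Otimes>\<^sub>M borel)"
  shows "(\<integral>\<^sup>+\<omega>. g (\<phi> (\<lambda>i\<in>{..<n}. \<xi> i \<omega>), \<xi> n \<omega>) \<partial>M) =
    (\<integral>\<^sup>+\<omega>. (\<integral>\<^sup>+z. ennreal (f z) * g (\<phi> (\<lambda>i\<in>{..<n}. \<xi> i \<omega>), z) \<partial>lborel) \<partial>M)"
proof -
  note [measurable] = \<phi>
  let ?S = "Pi\<^sub>M {..<n} (\<lambda>_. borel :: real measure)" and ?T = "Pi\<^sub>M {n} (\<lambda>_. borel :: real measure)"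
  let ?X = "\<lambda>\<omega>. \<lambda>i\<in>{..<n}. \<xi> i \<omega>" and ?Y = "\<lambda>\<omega>. \<lambda>i\<in>{n}. \<xi> i \<omega>"
  have indep: "indep_var ?S ?X ?T ?Y"
    using ind by (rule indep_var_restrict) auto
  then have [measurable]: "?X \<in> M \<rightarrow>\<^sub>M ?S" "?Y \<in> M \<rightarrow>\<^sub>M ?T"
    by (blast dest: indep_var_rv1 indep_var_rv2)+
  have [measurable]: "(\<lambda>u. u n) \<in> ?T \<rightarrow>\<^sub>M (borel :: real measure)"
    by (intro measurable_component_singleton) simp
  have [measurable]: "\<xi> n \<in> borel_measurable M"
    using distributed_measurable[OF dens] by simp
  have [measurable]: "(\<lambda>z. ennreal (f z)) \<in> borel_measurable borel"
    using distributed_borel_measurable[OF dens] by simp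
  interpret Y: prob_space "distr M ?T ?Y" by (rule prob_space_distr) simp
  have dist: "distr M borel (\<xi> n) = density lborel (\<lambda>z. ennreal (f z))"
    using distributed_distr_eq_density[OF dens] by (simp cong: distr_cong)
  have "(\<integral>\<^sup>+\<omega>. g (\<phi> (?X \<omega>), \<xi> n \<omega>) \<partial>M) = (\<integral>\<^sup>+\<omega>. g (\<phi> (?X \<omega>), ?Y \<omega> n) \<partial>M)"
    by simp
  also have "\<dots> = (\<integral>\<^sup>+p. g (\<phi> (fst p), snd p n) \<partial>distr M (?S \<Otimes>\<^sub>M ?T) (\<lambda>\<omega>. (?X \<omega>, ?Y \<omega>)))"
    by (subst nn_integral_distr) auto
  also have "\<dots> = (\<integral>\<^sup>+p. g (\<phi> (fst p), snd p n) \<partial>(distr M ?S ?X \<Otimes>\<^sub>M distr M ?T ?Y))"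
    using indep unfolding indep_var_distribution_eq by simp
  also have "\<dots> = (\<integral>\<^sup>+u. (\<integral>\<^sup>+v. g (\<phi> u, v n) \<partial>distr M ?T ?Y) \<partial>distr M ?S ?X)"
    by (subst Y.nn_integral_fst[symmetric]) (auto cong: nn_integral_cong)
  also have "\<dots> = (\<integral>\<^sup>+\<omega>. (\<integral>\<^sup>+v. g (\<phi> (?X \<omega>), v n) \<partial>distr M ?T ?Y) \<partial>M)"
    by (subst nn_integral_distr) auto
  also have "\<dots> = (\<integral>\<^sup>+\<omega>. (\<integral>\<^sup>+z. ennreal (f z) * g (\<phi> (?X \<omega>), z) \<partial>lborel) \<partial>M)"
  proof (intro nn_integral_cong)
    fix \<omega> assume "\<omega> \<in> space M"
    then have "?X \<omega> \<in> space ?S" by (simp add: space_PiM)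
    then have [measurable]: "\<phi> (?X \<omega>) \<in> space N" by (rule measurable_space[OF \<phi>])
    have "(\<integral>\<^sup>+v. g (\<phi> (?X \<omega>), v n) \<partial>distr M ?T ?Y) = (\<integral>\<^sup>+\<omega>'. g (\<phi> (?X \<omega>), \<xi> n \<omega>') \<partial>M)"
      by (subst nn_integral_distr) auto
    also have "\<dots> = (\<integral>\<^sup>+z. g (\<phi> (?X \<omega>), z) \<partial>distr M borel (\<xi> n))"
      by (subst nn_integral_distr) auto
    also have "\<dots> = (\<integral>\<^sup>+z. ennreal (f z) * g (\<phi> (?X \<omega>), z) \<partial>lborel)"
      unfolding dist by (subst nn_integral_density) auto
    finally show "(\<integral>\<^sup>+v. g (\<phi> (?X \<omega>), v n) \<partial>distr M ?T ?Y) = \<dots>" .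
  qed
  finally show ?thesis .
qed

locale negatively_drifted_brownian_motion =
  brownian_motion_with_drift P W "- \<delta> / 2" for P :: "'a measure" and W and \<delta> :: real +
  assumes \<delta>_pos: "\<delta> > 0"
begin

definition grid_incr :: "real \<Rightarrow> 'a \<Rightarrow> nat \<Rightarrow> real" where
  "grid_incr h \<omega> i = W (real (Suc i) * h) \<omega> - W (real i * h) \<omega>"

definition grid_walk :: "real \<Rightarrow> real \<Rightarrow> nat \<Rightarrow> 'a \<Rightarrow> real \<times> real \<times> real" where
  "grid_walk h x n \<omega> = walk h x (grid_incr h \<omega>) n"

lemma sum_grid_incr: "\<omega> \<in> space P \<Longrightarrow> (\<Sum>i<n. grid_incr h \<omega> i) = W (real n * h) \<omega>"
  unfolding grid_incr_def using sum_lessThan_telescope[of "\<lambda>i. W (real i * h) \<omega>" n] W_0 by simp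

lemma measurable_grid_incr [measurable]: "0 < h \<Longrightarrow> (\<lambda>\<omega>. grid_incr h \<omega> i) \<in> borel_measurable P"
  unfolding grid_incr_def using random_variable_W by (intro borel_measurable_diff) auto

lemma measurable_grid_walk [measurable]:
  assumes "0 < h"
  shows "grid_walk h x n \<in> P \<rightarrow>\<^sub>M borel \<Otimes>\<^sub>M borel \<Otimes>\<^sub>M borel"
proof (induction n)
  case (Suc n)
  note [measurable] = Suc measurable_grid_incr[OF assms]
  have "(\<lambda>\<omega>. case_prod (walk_step h x) (grid_walk h x n \<omega>, grid_incr h \<omega> n)) \<in> P \<rightarrow>\<^sub>M borel \<Otimes>\<^sub>M borel \<Otimes>\<^sub>M borel"
    by measurable
  then show ?case by (simp add: grid_walk_def[abs_def])
qed (simp add: grid_walk_def[abs_def])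

lemma grid_walk_restrict: "grid_walk h x n \<omega> = walk h x (\<lambda>i\<in>{..<n}. grid_incr h \<omega> i) n"
  by (auto simp: grid_walk_def intro!: walk_cong)

lemma grid_incr_indep:
  assumes "0 < h"
  shows "indep_vars (\<lambda>_. borel) (\<lambda>i \<omega>. grid_incr h \<omega> i) {..<n}"
  unfolding grid_incr_def using assms indep_increments[of "\<lambda>i. real i * h" n] by simp

lemma grid_incr_distributed:
  assumes "0 < h"
  shows "distributed P lborel (\<lambda>\<omega>. grid_incr h \<omega> n) (normal_density (- \<delta> / 2 * h) (sqrt h))"
  unfolding grid_incr_def using assms normal_increments[of "real n * h" "real (Suc n) * h"]
  by (simp add: algebra_simps)

lemma nn_integral_grid_walk_Suc:
  assumes "0 < h" and [measurable]: "g \<in> borel_measurable (borel \<Otimes>\<^sub>M borel \<Otimes>\<^sub>M borel)"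
  shows "(\<integral>\<^sup>+\<omega>. g (grid_walk h x (Suc n) \<omega>) \<partial>P) =
    (\<integral>\<^sup>+\<omega>. (\<integral>\<^sup>+z. ennreal (normal_density (- \<delta> / 2 * h) (sqrt h) z) *
      g (walk_step h x (grid_walk h x n \<omega>) z) \<partial>lborel) \<partial>P)"
proof -
  have "(\<lambda>q. g (case_prod (walk_step h x) q)) \<in>
      borel_measurable ((borel \<Otimes>\<^sub>M borel \<Otimes>\<^sub>M borel) \<Otimes>\<^sub>M borel)"
    by measurable
  from nn_integral_past_and_next[OF grid_incr_indep[OF assms(1)] grid_incr_distributed[OF assms(1)]
      measurable_walk[OF order.refl] this]
  have "(\<integral>\<^sup>+\<omega>. g (walk_step h x (grid_walk h x n \<omega>) (grid_incr h \<omega> n)) \<partial>P) =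
    (\<integral>\<^sup>+\<omega>. (\<integral>\<^sup>+z. ennreal (normal_density (- \<delta> / 2 * h) (sqrt h) z) *
      g (walk_step h x (grid_walk h x n \<omega>) z) \<partial>lborel) \<partial>P)"
    by (simp only: grid_walk_restrict split_conv)
  then show ?thesis by (simp add: grid_walk_def)
qed

lemma grid_walk_position_le_max: "snd (snd (grid_walk h x n \<omega>)) \<le> fst (snd (grid_walk h x n \<omega>))"
  unfolding grid_walk_def by (rule walk_position_le_max)

lemma grid_walk_position: "\<omega> \<in> space P \<Longrightarrow> snd (snd (grid_walk h x n \<omega>)) = W (real n * h) \<omega>"
  unfolding grid_walk_def by (simp add: walk_position sum_grid_incr)

lemma nn_integral_passage_value_ge:
  assumes "\<delta> \<le> \<theta>" "a = \<theta> * (\<theta> - \<delta>) / 2" "h > 0" "\<eta> > 0" "\<theta> * h \<le> \<eta>"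
    and c: "0 \<le> c" "c * overshoot_factor \<theta> h \<eta> \<le> 1" and "0 \<le> x" "x \<le> y"
  shows "ennreal (c\<^sup>2 * exp (- \<theta> * x - \<delta> * (y - x)))
    \<le> (\<integral>\<^sup>+\<omega>. ennreal (passage_value a \<theta> \<delta> x y c (grid_walk h x n \<omega>)) \<partial>P)"
proof (induction n)
  case 0
  then show ?case
    using assms by (simp add: grid_walk_def passage_value_def emeasure_space_1)
next
  case (Suc n)
  note Suc
  also have "(\<integral>\<^sup>+\<omega>. ennreal (passage_value a \<theta> \<delta> x y c (grid_walk h x n \<omega>)) \<partial>P)
      \<le> (\<integral>\<^sup>+\<omega>. (\<integral>\<^sup>+z. ennreal (normal_density (- \<delta> / 2 * h) (sqrt h) z) *
      ennreal (passage_value a \<theta> \<delta> x y c (walk_step h x (grid_walk h x n \<omega>) z)) \<partial>lborel) \<partial>P)"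
  proof (intro nn_integral_mono)
    fix \<omega>
    obtain \<tau> m s where q: "grid_walk h x n \<omega> = (\<tau>, m, s)" by (cases "grid_walk h x n \<omega>") auto
    with grid_walk_position_le_max[of h x n \<omega>] have "s \<le> m" by simp
    from passage_value_step_ge[OF \<delta>_pos assms(1-7) \<open>x \<le> y\<close> this]
    show "ennreal (passage_value a \<theta> \<delta> x y c (grid_walk h x n \<omega>))
      \<le> (\<integral>\<^sup>+z. ennreal (normal_density (- \<delta> / 2 * h) (sqrt h) z) *
      ennreal (passage_value a \<theta> \<delta> x y c (walk_step h x (grid_walk h x n \<omega>) z)) \<partial>lborel)"
      unfolding q .
  qed
  also have "\<dots> = (\<integral>\<^sup>+\<omega>. ennreal (passage_value a \<theta> \<delta> x y c (grid_walk h x (Suc n) \<omega>)) \<partial>P)"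
    using assms(3) by (intro nn_integral_grid_walk_Suc[symmetric]) auto
  finally show ?case .
qed

lemma nn_integral_passage_value_le:
  assumes "\<delta> \<le> \<theta>" "a = \<theta> * (\<theta> - \<delta>) / 2" "h > 0" and "0 \<le> x" "x \<le> y"
  shows "(\<integral>\<^sup>+\<omega>. ennreal (passage_value a \<theta> \<delta> x y 1 (grid_walk h x n \<omega>)) \<partial>P)
    \<le> ennreal (exp (- \<theta> * x - \<delta> * (y - x)))"
proof (induction n)
  case 0
  then show ?case
    using assms by (simp add: grid_walk_def passage_value_def emeasure_space_1)
next
  case (Suc n)
  have "(\<integral>\<^sup>+\<omega>. ennreal (passage_value a \<theta> \<delta> x y 1 (grid_walk h x (Suc n) \<omega>)) \<partial>P) =
     (\<integral>\<^sup>+\<omega>. (\<integral>\<^sup>+z. ennreal (normal_density (- \<delta> / 2 * h) (sqrt h) z) *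
      ennreal (passage_value a \<theta> \<delta> x y 1 (walk_step h x (grid_walk h x n \<omega>) z)) \<partial>lborel) \<partial>P)"
    using assms(3) by (intro nn_integral_grid_walk_Suc) auto
  also have "\<dots> \<le> (\<integral>\<^sup>+\<omega>. ennreal (passage_value a \<theta> \<delta> x y 1 (grid_walk h x n \<omega>)) \<partial>P)"
  proof (intro nn_integral_mono)
    fix \<omega>
    obtain \<tau> m s where q: "grid_walk h x n \<omega> = (\<tau>, m, s)" by (cases "grid_walk h x n \<omega>") auto
    with grid_walk_position_le_max[of h x n \<omega>] have "s \<le> m" by simp
    from passage_value_step_le[OF \<delta>_pos assms(1-3) \<open>x \<le> y\<close> this]
    show "(\<integral>\<^sup>+z. ennreal (normal_density (- \<delta> / 2 * h) (sqrt h) z) *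
      ennreal (passage_value a \<theta> \<delta> x y 1 (walk_step h x (grid_walk h x n \<omega>) z)) \<partial>lborel)
      \<le> ennreal (passage_value a \<theta> \<delta> x y 1 (grid_walk h x n \<omega>))"
      unfolding q .
  qed
  also note Suc
  finally show ?case .
qed

definition grid_passage :: "real \<Rightarrow> real \<Rightarrow> real \<Rightarrow> real \<Rightarrow> nat \<Rightarrow> 'a \<Rightarrow> real" where
  "grid_passage a x y h n \<omega> =
    (case grid_walk h x n \<omega> of (\<tau>, m, s) \<Rightarrow> if y < m then exp (- a * \<tau>) else 0)"

lemma measurable_grid_passage [measurable]:
  assumes "0 < h"
  shows "grid_passage a x y h n \<in> borel_measurable P"
proof -
  note [measurable] = measurable_grid_walk[OF assms]
  show ?thesis unfolding grid_passage_def[abs_def] case_prod_beta by measurable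
qed

lemma nn_integral_exp_W:
  assumes "0 < t"
  shows "(\<integral>\<^sup>+\<omega>. ennreal (exp (\<kappa> * W t \<omega>)) \<partial>P) = ennreal (exp (\<kappa> * (\<kappa> - \<delta>) / 2 * t))"
proof -
  have "distributed P lborel (\<lambda>\<omega>. W t \<omega> - W 0 \<omega>) (normal_density (- \<delta> / 2 * t) (sqrt t))"
    using normal_increments[of 0 t] assms by simp
  from distributed_nn_integral[OF this, of "\<lambda>z. ennreal (exp (\<kappa> * z))"]
  have "(\<integral>\<^sup>+\<omega>. ennreal (exp (\<kappa> * (W t \<omega> - W 0 \<omega>))) \<partial>P) =
     (\<integral>\<^sup>+z. ennreal (normal_density (- \<delta> / 2 * t) (sqrt t) z) * ennreal (exp (\<kappa> * z)) \<partial>lborel)"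
    by simp
  also have "\<dots> = ennreal (exp (\<kappa> * (\<kappa> - \<delta>) / 2 * t))"
    using assms by (subst nn_integral_normal_density_exp) (simp_all add: power2_eq_square field_simps)
  finally show ?thesis
    by (simp add: W_0 cong: nn_integral_cong_simp)
qed

text \<open>
  Starting from position 0, the value is \<open>c\<^sup>2 exp (- \<theta> x - \<delta> (y - x))\<close>. The sub- and supermartingale
  properties carry it to time \<open>n\<close>, where the value is \<open>grid_passage\<close> up to the residual.
\<close>

lemma expectation_grid_passage_bounds:
  assumes "\<delta> \<le> \<theta>" "a = \<theta> * (\<theta> - \<delta>) / 2" "h > 0" "\<eta> > 0" "\<theta> * h \<le> \<eta>" "0 \<le> x" "x \<le> y" "0 < n"
  shows "exp (- \<theta> * x - \<delta> * (y - x)) / (overshoot_factor \<theta> h \<eta>)\<^sup>2 - exp (- \<delta> / 2 * y - \<delta>\<^sup>2 / 8 * (real n * h))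
      \<le> expectation (grid_passage a x y h n)"
    and "expectation (grid_passage a x y h n) \<le> exp (- \<theta> * x - \<delta> * (y - x))"
proof -
  note [measurable] = measurable_grid_passage[OF \<open>h > 0\<close>] measurable_grid_walk[OF \<open>h > 0\<close>]
  have a0: "0 \<le> a" unfolding assms(2) using assms(1) \<delta>_pos by simp
  have pos: "0 \<le> grid_passage a x y h n \<omega>" for \<omega>
    by (auto simp: grid_passage_def split: prod.splits)
  have "0 \<le> fst (grid_walk h x n \<omega>)" for \<omega>
    using assms by (simp add: grid_walk_def walk_time_nonneg)
  then have le1: "grid_passage a x y h n \<omega> \<le> 1" for \<omega>
    using a0 by (auto simp: grid_passage_def split: prod.splits)
       (metis fst_conv mult_nonneg_nonneg)
  have int: "integrable P (grid_passage a x y h n)"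
    using pos le1 by (intro integrable_const_bound[where B=1]) auto
  then have eq: "(\<integral>\<^sup>+\<omega>. ennreal (grid_passage a x y h n \<omega>) \<partial>P) = ennreal (expectation (grid_passage a x y h n))"
    using pos by (intro nn_integral_eq_integral) auto
  have E0: "0 \<le> expectation (grid_passage a x y h n)" using pos by (intro Bochner_Integration.integral_nonneg) auto
  have "ennreal (expectation (grid_passage a x y h n)) \<le>
      (\<integral>\<^sup>+\<omega>. ennreal (passage_value a \<theta> \<delta> x y 1 (grid_walk h x n \<omega>)) \<partial>P)"
    unfolding eq[symmetric]
    by (intro nn_integral_mono) (auto simp: grid_passage_def passage_value_def split: prod.splits)
  also have "\<dots> \<le> ennreal (exp (- \<theta> * x - \<delta> * (y - x)))"
    using assms by (intro nn_integral_passage_value_le) auto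
  finally show "expectation (grid_passage a x y h n) \<le> exp (- \<theta> * x - \<delta> * (y - x))"
    by simp
  define c where "c = 1 / overshoot_factor \<theta> h \<eta>"
  have C1: "1 \<le> overshoot_factor \<theta> h \<eta>"
    using assms \<delta>_pos by (intro overshoot_factor_ge_1) auto
  have c: "0 \<le> c" "c \<le> 1" "c * overshoot_factor \<theta> h \<eta> \<le> 1"
    using C1 by (auto simp: c_def)
  have "ennreal (c\<^sup>2 * exp (- \<theta> * x - \<delta> * (y - x)))
    \<le> (\<integral>\<^sup>+\<omega>. ennreal (passage_value a \<theta> \<delta> x y c (grid_walk h x n \<omega>)) \<partial>P)"
    using assms c by (intro nn_integral_passage_value_ge) auto
  also have "\<dots> \<le> (\<integral>\<^sup>+\<omega>. ennreal (grid_passage a x y h n \<omega>) +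
      ennreal (exp (- \<delta> / 2 * y)) * ennreal (exp (\<delta> / 2 * W (real n * h) \<omega>)) \<partial>P)"
  proof (intro nn_integral_mono)
    fix \<omega> assume "\<omega> \<in> space P"
    obtain \<tau> m s where q: "grid_walk h x n \<omega> = (\<tau>, m, s)" by (cases "grid_walk h x n \<omega>") auto
    have "s \<le> m" using grid_walk_position_le_max[of h x n \<omega>] q by simp
    have "s = W (real n * h) \<omega>" using grid_walk_position[of \<omega> h x n] q \<open>\<omega> \<in> space P\<close> by simp
    have "0 \<le> \<tau>" using assms walk_time_nonneg[of h x "grid_incr h \<omega>" n] q by (simp add: grid_walk_def)
    have "passage_value a \<theta> \<delta> x y c (\<tau>, m, s)
      \<le> (if y < m then exp (- a * \<tau>) else 0) + exp (- \<delta> / 2 * (y - s))"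
      using assms a0 c \<delta>_pos \<open>s \<le> m\<close> \<open>0 \<le> \<tau>\<close> by (intro passage_value_residual) auto
    also have "\<dots> = grid_passage a x y h n \<omega> + exp (- \<delta> / 2 * y) * exp (\<delta> / 2 * W (real n * h) \<omega>)"
      using \<open>s = _\<close> by (simp add: grid_passage_def q exp_add[symmetric] algebra_simps diff_divide_distrib)
    finally show "ennreal (passage_value a \<theta> \<delta> x y c (grid_walk h x n \<omega>)) \<le>
       ennreal (grid_passage a x y h n \<omega>) + ennreal (exp (- \<delta> / 2 * y)) * ennreal (exp (\<delta> / 2 * W (real n * h) \<omega>))"
      using pos[of \<omega>] by (simp add: q ennreal_mult[symmetric] ennreal_plus[symmetric] ennreal_leI del: ennreal_plus)
  qed
  also have "\<dots> = ennreal (expectation (grid_passage a x y h n)) +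
      ennreal (exp (- \<delta> / 2 * y)) * (\<integral>\<^sup>+\<omega>. ennreal (exp (\<delta> / 2 * W (real n * h) \<omega>)) \<partial>P)"
    using random_variable_W[of "real n * h"] assms(3) eq
    by (subst nn_integral_add) (auto simp: nn_integral_cmult)
  also have "\<dots> = ennreal (expectation (grid_passage a x y h n) +
      exp (- \<delta> / 2 * y) * exp (\<delta> / 2 * (\<delta> / 2 - \<delta>) / 2 * (real n * h)))"
    using assms E0 by (subst nn_integral_exp_W) (auto simp: ennreal_mult[symmetric] ennreal_plus)
  also have "exp (- \<delta> / 2 * y) * exp (\<delta> / 2 * (\<delta> / 2 - \<delta>) / 2 * (real n * h)) =
      exp (- \<delta> / 2 * y - \<delta>\<^sup>2 / 8 * (real n * h))"
    by (simp add: exp_add[symmetric] power2_eq_square field_simps)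
  finally have "c\<^sup>2 * exp (- \<theta> * x - \<delta> * (y - x)) \<le> expectation (grid_passage a x y h n) +
      exp (- \<delta> / 2 * y - \<delta>\<^sup>2 / 8 * (real n * h))"
    using E0 by (subst (asm) ennreal_le_iff) (auto intro: add_nonneg_nonneg)
  then show "exp (- \<theta> * x - \<delta> * (y - x)) / (overshoot_factor \<theta> h \<eta>)\<^sup>2 - exp (- \<delta> / 2 * y - \<delta>\<^sup>2 / 8 * (real n * h))
      \<le> expectation (grid_passage a x y h n)"
    by (simp add: c_def power_divide)
qed

end

section \<open>First passage in continuous time\<close>

lemma grid_point_tendsto:
  fixes h :: "nat \<Rightarrow> real" and n :: "nat \<Rightarrow> nat"
  assumes "\<And>k. 0 < h k" "h \<longlonglongrightarrow> 0" "filterlim (\<lambda>k. real (n k) * h k) at_top sequentially" "0 \<le> t"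
  obtains j :: "nat \<Rightarrow> nat" where "(\<lambda>k. real (j k) * h k) \<longlonglongrightarrow> t" "\<forall>\<^sub>F k in sequentially. j k \<le> n k"
proof -
  define j where "j k = nat \<lceil>t / h k\<rceil>" for k
  have lower: "t \<le> real (j k) * h k" and upper: "real (j k) * h k \<le> t + h k" for k
  proof -
    have "0 \<le> t / h k" using assms(1)[of k] assms(4) by simp
    then have "real (j k) = of_int \<lceil>t / h k\<rceil>" by (simp add: j_def)
    then have "t / h k \<le> real (j k)" "real (j k) \<le> t / h k + 1"
      by linarith+
    then have "t / h k * h k \<le> real (j k) * h k" "real (j k) * h k \<le> (t / h k + 1) * h k"
      using assms(1)[of k] by (intro mult_right_mono; simp)+
    then show "t \<le> real (j k) * h k" "real (j k) * h k \<le> t + h k"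
      using assms(1)[of k] by (simp_all add: distrib_right)
  qed
  have lim: "(\<lambda>k. t + h k) \<longlonglongrightarrow> t" using tendsto_add[OF tendsto_const assms(2)] by simp
  have "(\<lambda>k. real (j k) * h k) \<longlonglongrightarrow> t"
    by (rule tendsto_sandwich[OF always_eventually[OF allI[OF lower]]
          always_eventually[OF allI[OF upper]] tendsto_const lim])
  moreover have "\<forall>\<^sub>F k in sequentially. h k < 1" using assms(2) by (rule order_tendstoD) simp
  then have "\<forall>\<^sub>F k in sequentially. j k \<le> n k"
    using eventually_compose_filterlim[OF eventually_ge_at_top[of "t + 1"] assms(3)]
  proof eventually_elim
    case (elim k)
    then have "real (j k) * h k \<le> real (n k) * h k" using upper[of k] by linarith
    then have "real (j k) \<le> real (n k)" using assms(1)[of k] by (rule mult_right_le_imp_le)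
    then show ?case by (simp only: of_nat_le_iff)
  qed
  ultimately show thesis by (rule that)
qed

context negatively_drifted_brownian_motion
begin

text \<open>
  The strict inequality matters: exceeding a level is an open condition on the path,
  hence visible on a fine grid, whereas the first time of reaching a level need not be.
\<close>

definition first_passage :: "real \<Rightarrow> 'a \<Rightarrow> real" where
  "first_passage x \<omega> = Inf {t. 0 \<le> t \<and> x < W t \<omega>}"

definition passage :: "real \<Rightarrow> real \<Rightarrow> real \<Rightarrow> 'a \<Rightarrow> real" where
  "passage a x y \<omega> = (if \<exists>t\<ge>0. y < W t \<omega> then exp (- a * first_passage x \<omega>) else 0)"

lemma first_passage_le: "0 \<le> t \<Longrightarrow> x < W t \<omega> \<Longrightarrow> first_passage x \<omega> \<le> t"
  unfolding first_passage_def by (intro cInf_lower bdd_belowI[of _ 0]) auto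

lemma first_passage_nonneg: "\<exists>t\<ge>0. x < W t \<omega> \<Longrightarrow> 0 \<le> first_passage x \<omega>"
  unfolding first_passage_def by (intro cInf_greatest) auto

lemma first_passage_lessD:
  "\<exists>t\<ge>0. x < W t \<omega> \<Longrightarrow> first_passage x \<omega> < u \<Longrightarrow> \<exists>t\<ge>0. x < W t \<omega> \<and> t < u"
  unfolding first_passage_def using cInf_lessD[of "{t. 0 \<le> t \<and> x < W t \<omega>}" u] by auto

text \<open>
  A grid passage is never earlier than the true one. Conversely, a time shortly after the true passage
  at which the path exceeds \<open>x\<close> is approximated by grid points at which it still does.
\<close>

lemma grid_passage_tendsto:
  fixes h :: "nat \<Rightarrow> real" and n :: "nat \<Rightarrow> nat"
  assumes h: "\<And>k. 0 < h k" "h \<longlonglongrightarrow> 0" "filterlim (\<lambda>k. real (n k) * h k) at_top sequentially"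
    and "0 \<le> x" "x \<le> y" and \<omega>: "\<omega> \<in> space P"
  shows "(\<lambda>k. grid_passage a x y (h k) (n k) \<omega>) \<longlonglongrightarrow> passage a x y \<omega>"
proof -
  let ?\<tau> = "\<lambda>k. fst (grid_walk (h k) x (n k) \<omega>)" and ?m = "\<lambda>k. fst (snd (grid_walk (h k) x (n k) \<omega>))"
  have max_gt: "z < ?m k \<longleftrightarrow> (\<exists>j\<le>n k. z < W (real j * h k) \<omega>)" if "0 \<le> z" for z k
    unfolding grid_walk_def using walk_max_gt_iff[OF that] sum_grid_incr[OF \<omega>] by simp
  have approx: "\<exists>j. (\<lambda>k. real (j k) * h k) \<longlonglongrightarrow> t \<and>
      (\<forall>\<^sub>F k in sequentially. j k \<le> n k \<and> z < W (real (j k) * h k) \<omega>)"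
    if "0 \<le> t" "z < W t \<omega>" for t z
  proof -
    obtain j where j: "(\<lambda>k. real (j k) * h k) \<longlonglongrightarrow> t" "\<forall>\<^sub>F k in sequentially. j k \<le> n k"
      using grid_point_tendsto[where h=h and n=n, OF h \<open>0 \<le> t\<close>] by metis
    have h_nonneg: "0 \<le> h k" for k using h(1)[of k] by simp
    have "(\<lambda>k. W (real (j k) * h k) \<omega>) \<longlonglongrightarrow> W t \<omega>"
      using continuous_paths[OF \<omega>] j(1) that(1)
      by (intro continuous_on_tendsto_compose[where f="\<lambda>t. W t \<omega>" and s="{0..}"] always_eventually)
        (auto intro!: mult_nonneg_nonneg h_nonneg)
    then have "\<forall>\<^sub>F k in sequentially. z < W (real (j k) * h k) \<omega>"
      using that(2) by (rule order_tendstoD)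
    with j show ?thesis by (auto intro: eventually_conj)
  qed
  have gp: "grid_passage a x y (h k) (n k) \<omega> = (if y < ?m k then exp (- a * ?\<tau> k) else 0)" for k
    by (simp add: grid_passage_def split: prod.splits)
  show ?thesis
  proof (cases "\<exists>t\<ge>0. y < W t \<omega>")
    case False
    have "\<not> y < ?m k" for k
    proof
      assume "y < ?m k"
      then obtain j where "y < W (real j * h k) \<omega>" using max_gt[of y k] assms by auto
      moreover have "0 \<le> real j * h k" using h(1)[of k] by simp
      ultimately show False using False by blast
    qed
    then have "grid_passage a x y (h k) (n k) \<omega> = 0" for k
      by (simp add: gp)
    moreover have "passage a x y \<omega> = 0"
      using False unfolding passage_def by (rule if_not_P)
    ultimately show ?thesis by simp
  next
    case True
    then obtain t0 where t0: "0 \<le> t0" "y < W t0 \<omega>" by auto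
    have ex: "\<exists>t\<ge>0. x < W t \<omega>"
      using t0 \<open>x \<le> y\<close> by (intro exI[of _ t0]) simp
    have ev: "\<forall>\<^sub>F k in sequentially. y < ?m k"
    proof -
      obtain j where "\<forall>\<^sub>F k in sequentially. j k \<le> n k \<and> y < W (real (j k) * h k) \<omega>"
        using approx[OF t0] by auto
      then show ?thesis
        using max_gt[of y] assms(4,5) by (auto elim!: eventually_mono)
    qed
    have time: "first_passage x \<omega> \<le> ?\<tau> k \<and> (\<forall>j\<le>n k. x < W (real j * h k) \<omega> \<longrightarrow> ?\<tau> k \<le> real j * h k)"
      if "y < ?m k" for k
    proof -
      have "x < ?m k" using that \<open>x \<le> y\<close> by simp
      then have "\<not> (\<forall>j\<le>n k. W (real j * h k) \<omega> \<le> x)"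
        using max_gt[OF \<open>0 \<le> x\<close>] by (auto simp: not_le)
      then obtain j where j: "?\<tau> k = real j * h k" "x < W (real j * h k) \<omega>" "\<forall>i<j. W (real i * h k) \<omega> \<le> x"
        using walk_time_eq[OF \<open>0 \<le> x\<close>, of "n k" "grid_incr (h k) \<omega>" "h k"]
        unfolding grid_walk_def sum_grid_incr[OF \<omega>] by blast
      have "first_passage x \<omega> \<le> ?\<tau> k"
        unfolding j(1) using j(2) h(1)[of k] by (intro first_passage_le) simp_all
      moreover have "?\<tau> k \<le> real i * h k" if "x < W (real i * h k) \<omega>" for i
      proof -
        have "j \<le> i" using j(3) that by (meson not_less)
        then show ?thesis using j(1) h(1)[of k] by (simp add: mult_right_mono)
      qed
      ultimately show ?thesis by auto
    qed
    have "?\<tau> \<longlonglongrightarrow> first_passage x \<omega>"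
    proof (rule order_tendstoI)
      fix l assume "l < first_passage x \<omega>"
      then have "l < ?\<tau> k" if "y < ?m k" for k
        using time[OF that] by linarith
      with ev show "\<forall>\<^sub>F k in sequentially. l < ?\<tau> k"
        by (rule eventually_mono)
    next
      fix u assume "first_passage x \<omega> < u"
      then obtain t where t: "0 \<le> t" "x < W t \<omega>" "t < u"
        using first_passage_lessD[OF ex] by auto
      obtain j where j: "(\<lambda>k. real (j k) * h k) \<longlonglongrightarrow> t"
         "\<forall>\<^sub>F k in sequentially. j k \<le> n k \<and> x < W (real (j k) * h k) \<omega>"
        using approx[OF t(1,2)] by auto
      have "\<forall>\<^sub>F k in sequentially. real (j k) * h k < u"
        using j(1) t(3) by (rule order_tendstoD)
      with ev j(2) show "\<forall>\<^sub>F k in sequentially. ?\<tau> k < u"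
      proof eventually_elim
        case (elim k)
        then have "?\<tau> k \<le> real (j k) * h k" using time[of k] by blast
        then show ?case using elim(3) by linarith
      qed
    qed
    then have "(\<lambda>k. exp (- a * ?\<tau> k)) \<longlonglongrightarrow> passage a x y \<omega>"
      using True by (auto simp: passage_def intro!: tendsto_intros)
    moreover have "\<forall>\<^sub>F k in sequentially. exp (- a * ?\<tau> k) = grid_passage a x y (h k) (n k) \<omega>"
      using ev by eventually_elim (simp add: gp)
    ultimately show ?thesis by (rule Lim_transform_eventually)
  qed
qed

lemma grid_passage_bounded:
  assumes "0 \<le> a" "0 < h"
  shows "0 \<le> grid_passage a x y h n \<omega>" "grid_passage a x y h n \<omega> \<le> 1"
proof -
  have "0 \<le> fst (grid_walk h x n \<omega>)"
    using assms by (simp add: grid_walk_def walk_time_nonneg)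
  then show "0 \<le> grid_passage a x y h n \<omega>" "grid_passage a x y h n \<omega> \<le> 1"
    using assms(1) by (auto simp: grid_passage_def split: prod.splits)
qed

lemma
  assumes \<theta>: "\<delta> \<le> \<theta>" "a = \<theta> * (\<theta> - \<delta>) / 2" and xy: "0 \<le> x" "x \<le> y"
  shows measurable_passage: "passage a x y \<in> borel_measurable P"
    and expectation_passage: "expectation (passage a x y) = exp (- \<theta> * x - \<delta> * (y - x))"
proof -
  \<comment> \<open>With \<open>s = k + 1\<close>: mesh \<open>s^(-4)\<close>, horizon \<open>s\<close> and cutoff \<open>s^(-1)\<close>, so that \<open>\<eta>\<^sup>2 / h = s\<^sup>2\<close> and \<open>\<eta> / h = s\<^sup>3\<close> both diverge.\<close>
  define h :: "nat \<Rightarrow> real" where "h k = 1 / real (Suc k) ^ 4" for k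
  define n :: "nat \<Rightarrow> nat" where "n k = Suc k ^ 5" for k
  define \<eta> :: "nat \<Rightarrow> real" where "\<eta> k = 1 / real (Suc k)" for k
  have arith: "u ^ 5 * (1 / u ^ 4) = u" "(1 / u)\<^sup>2 / (2 * (1 / u ^ 4)) = u\<^sup>2 / 2" "u ^ 3 * (1 / u ^ 4) = 1 / u"
    if "0 < u" for u :: real
    using that by (simp_all add: divide_simps power_numeral_reduce)
  have a0: "0 \<le> a" unfolding \<theta>(2) using \<theta>(1) \<delta>_pos by simp
  have h: "0 < h k" for k by (simp add: h_def)
  have h0: "h \<longlonglongrightarrow> 0" unfolding h_def by real_asymp
  have nh: "real (n k) * h k = real (Suc k)" for k
    using arith(1)[of "real (Suc k)"] by (simp add: n_def h_def del: of_nat_Suc)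
  have nh_top: "filterlim (\<lambda>k. real (n k) * h k) at_top sequentially"
    unfolding nh by real_asymp
  have grid_meas: "grid_passage a x y (h k) (n k) \<in> borel_measurable P" for k
    using h by (rule measurable_grid_passage)
  have lim: "(\<lambda>k. grid_passage a x y (h k) (n k) \<omega>) \<longlonglongrightarrow> passage a x y \<omega>" if "\<omega> \<in> space P" for \<omega>
    using h h0 nh_top xy that by (rule grid_passage_tendsto)
  show meas: "passage a x y \<in> borel_measurable P"
    using lim grid_meas by (rule borel_measurable_LIMSEQ_real)
  have conv: "(\<lambda>k. expectation (grid_passage a x y (h k) (n k))) \<longlonglongrightarrow> expectation (passage a x y)"
  proof (rule integral_dominated_convergence[where w="\<lambda>_. 1"])
    show "AE \<omega> in P. norm (grid_passage a x y (h k) (n k) \<omega>) \<le> 1" for k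
      using grid_passage_bounded[OF a0 h] by simp
  qed (use meas grid_meas lim in simp_all)
  let ?E = "exp (- \<theta> * x - \<delta> * (y - x))"
  have lower_lim: "(\<lambda>k. ?E / (overshoot_factor \<theta> (h k) (\<eta> k))\<^sup>2 - exp (- \<delta> / 2 * y - \<delta>\<^sup>2 / 8 * (real (n k) * h k)))
     \<longlonglongrightarrow> ?E / 1\<^sup>2 - 0"
  proof (intro tendsto_intros)
    have "overshoot_factor \<theta> (h k) (\<eta> k) = exp (\<theta> * (1 / real (Suc k))) * (1 + exp (- (real (Suc k))\<^sup>2 / 2))" for k
      using arith(2)[of "real (Suc k)"]
      unfolding overshoot_factor_def h_def \<eta>_def by (simp del: of_nat_Suc)
    moreover have "(\<lambda>k. exp (\<theta> * (1 / real (Suc k))) * (1 + exp (- (real (Suc k))\<^sup>2 / 2))) \<longlonglongrightarrow> 1"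
      by real_asymp
    ultimately show "(\<lambda>k. overshoot_factor \<theta> (h k) (\<eta> k)) \<longlonglongrightarrow> 1" by simp
    show "(\<lambda>k. exp (- \<delta> / 2 * y - \<delta>\<^sup>2 / 8 * (real (n k) * h k))) \<longlonglongrightarrow> 0"
      unfolding nh using \<delta>_pos by real_asymp
  qed simp
  have fine: "\<forall>\<^sub>F k in sequentially. \<theta> * h k \<le> \<eta> k"
  proof -
    have "\<forall>\<^sub>F k in sequentially. \<theta> \<le> real (Suc k) ^ 3" by real_asymp
    then show ?thesis
    proof eventually_elim
      case (elim k)
      then have "\<theta> * h k \<le> real (Suc k) ^ 3 * h k" using h[of k] by (intro mult_right_mono) auto
      also have "\<dots> = \<eta> k" 
        using arith(3)[of "real (Suc k)"] by (simp add: h_def \<eta>_def del: of_nat_Suc)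
      finally show ?case .
    qed
  qed
  have bounds: "?E / (overshoot_factor \<theta> (h k) (\<eta> k))\<^sup>2
        - exp (- \<delta> / 2 * y - \<delta>\<^sup>2 / 8 * (real (n k) * h k)) \<le> expectation (grid_passage a x y (h k) (n k))"
      "expectation (grid_passage a x y (h k) (n k)) \<le> ?E" if "\<theta> * h k \<le> \<eta> k" for k
  proof -
    have "0 < \<eta> k" "0 < n k" by (simp_all add: \<eta>_def n_def)
    then show "?E / (overshoot_factor \<theta> (h k) (\<eta> k))\<^sup>2
        - exp (- \<delta> / 2 * y - \<delta>\<^sup>2 / 8 * (real (n k) * h k)) \<le> expectation (grid_passage a x y (h k) (n k))"
      "expectation (grid_passage a x y (h k) (n k)) \<le> ?E"
      using expectation_grid_passage_bounds[OF \<theta> h _ that xy] by blast+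
  qed
  have "(\<lambda>k. expectation (grid_passage a x y (h k) (n k))) \<longlonglongrightarrow> ?E"
  proof (rule tendsto_sandwich)
    show "\<forall>\<^sub>F k in sequentially. ?E / (overshoot_factor \<theta> (h k) (\<eta> k))\<^sup>2
        - exp (- \<delta> / 2 * y - \<delta>\<^sup>2 / 8 * (real (n k) * h k)) \<le> expectation (grid_passage a x y (h k) (n k))"
      using fine by eventually_elim (rule bounds)
    show "\<forall>\<^sub>F k in sequentially. expectation (grid_passage a x y (h k) (n k)) \<le> ?E"
      using fine by eventually_elim (rule bounds)
  qed (use lower_lim in simp_all)
  with conv show "expectation (passage a x y) = ?E"
    by (rule LIMSEQ_unique)
qed

section \<open>The supremum and its location as random variables\<close>

lemma
  assumes "0 \<le> y"
  shows sets_exceeds: "{\<omega> \<in> space P. \<exists>t\<ge>0. y < W t \<omega>} \<in> events"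
    and prob_exceeds: "prob {\<omega> \<in> space P. \<exists>t\<ge>0. y < W t \<omega>} = exp (- \<delta> * y)"
proof -
  let ?U = "{\<omega> \<in> space P. \<exists>t\<ge>0. y < W t \<omega>}"
  have passage_eq: "passage 0 y y \<omega> = indicator ?U \<omega>" if "\<omega> \<in> space P" for \<omega>
    using that unfolding passage_def by (auto simp: indicator_def)
  have meas: "passage 0 y y \<in> borel_measurable P"
    by (rule measurable_passage[where \<theta>=\<delta>]) (use assms in simp_all)
  have "?U = passage 0 y y -` {1} \<inter> space P"
    using passage_eq by (auto simp: indicator_def split: if_splits)
  also have "\<dots> \<in> events" using meas by (rule measurable_sets) simp
  finally show U: "?U \<in> events" .
  have "prob ?U = expectation (indicator ?U)" using U by simp
  also have "\<dots> = expectation (passage 0 y y)"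
    using passage_eq by (intro Bochner_Integration.integral_cong) auto
  also have "\<dots> = exp (- \<delta> * y)"
    using expectation_passage[of \<delta> 0 y y] assms by simp
  finally show "prob ?U = exp (- \<delta> * y)" .
qed

abbreviation path_bounded :: "'a \<Rightarrow> bool" where
  "path_bounded \<omega> \<equiv> bdd_above ((\<lambda>t. W t \<omega>) ` {0..})"

abbreviation sup_attained :: "'a \<Rightarrow> bool" where
  "sup_attained \<omega> \<equiv> \<exists>t\<ge>0. W t \<omega> = overall_sup W \<omega>"

lemma path_unbounded_iff: "\<not> path_bounded \<omega> \<longleftrightarrow> (\<forall>k::nat. \<exists>t\<ge>0. real k < W t \<omega>)"
proof
  assume "\<not> path_bounded \<omega>"
  then show "\<forall>k::nat. \<exists>t\<ge>0. real k < W t \<omega>"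
    by (force simp: bdd_above_def not_le)
next
  assume *: "\<forall>k::nat. \<exists>t\<ge>0. real k < W t \<omega>"
  show "\<not> path_bounded \<omega>"
  proof
    assume "path_bounded \<omega>"
    then obtain B where B: "\<And>t. 0 \<le> t \<Longrightarrow> W t \<omega> \<le> B" by (auto simp: bdd_above_def)
    obtain k :: nat where "B \<le> real k" using real_arch_simple by blast
    then show False using * B by (meson leD order.trans)
  qed
qed

lemma sets_path_unbounded: "{\<omega> \<in> space P. \<not> path_bounded \<omega>} \<in> events"
proof -
  have "{\<omega> \<in> space P. \<not> path_bounded \<omega>} = (\<Inter>k::nat. {\<omega> \<in> space P. \<exists>t\<ge>0. real k < W t \<omega>})"
    unfolding path_unbounded_iff by auto
  then show ?thesis using sets_exceeds by (auto intro!: sets.countable_INT)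
qed

lemma AE_path_bounded: "AE \<omega> in P. path_bounded \<omega>"
proof -
  let ?N = "{\<omega> \<in> space P. \<not> path_bounded \<omega>}"
  have le: "prob ?N \<le> exp (- \<delta> * real k)" for k :: nat
  proof -
    have "prob ?N \<le> prob {\<omega> \<in> space P. \<exists>t\<ge>0. real k < W t \<omega>}"
      using sets_exceeds path_unbounded_iff by (intro finite_measure_mono) auto
    then show ?thesis using prob_exceeds[of "real k"] by simp
  qed
  have "(\<lambda>k::nat. exp (- \<delta> * real k)) \<longlonglongrightarrow> 0"
    using \<delta>_pos by real_asymp
  then have "prob ?N \<le> 0" using le by (intro LIMSEQ_le_const) auto
  then have "prob ?N = 0" using measure_nonneg[of P ?N] by linarith
  then show ?thesis
    using AE_iff_measurable[OF sets_path_unbounded refl] by (simp add: emeasure_eq_measure)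
qed

lemma AE_exceeds_0: "AE \<omega> in P. \<exists>t\<ge>0. 0 < W t \<omega>"
proof -
  have "AE \<omega> in P. \<omega> \<in> {\<omega> \<in> space P. \<exists>t\<ge>0. 0 < W t \<omega>}"
    using prob_exceeds[of 0] sets_exceeds[of 0] by (subst AE_in_set_eq_1) auto
  then show ?thesis by (auto elim!: AE_mp)
qed

lemma less_overall_sup_iff:
  "path_bounded \<omega> \<Longrightarrow> y < overall_sup W \<omega> \<longleftrightarrow> (\<exists>t\<ge>0. y < W t \<omega>)"
  unfolding overall_sup_def by (subst less_cSUP_iff) auto

lemma le_overall_sup: "path_bounded \<omega> \<Longrightarrow> 0 \<le> t \<Longrightarrow> W t \<omega> \<le> overall_sup W \<omega>"
  unfolding overall_sup_def by (intro cSUP_upper) auto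

text \<open>
  The supremum of an unbounded set of reals is some fixed but unknown number. Unbounded paths form
  a null event that need not be empty, so measurability has to be checked there too.
\<close>

lemma overall_sup_unbounded:
  assumes "\<not> path_bounded \<omega>"
  shows "overall_sup W \<omega> = Sup UNIV"
proof -
  have "(\<lambda>z. \<forall>v\<in>(\<lambda>t. W t \<omega>) ` {0..}. v \<le> z) = (\<lambda>z. False)"
    using assms by (auto simp: bdd_above_def fun_eq_iff)
  moreover have "(\<lambda>z. \<forall>v\<in>(UNIV :: real set). v \<le> z) = (\<lambda>z. False)"
    by (auto simp: fun_eq_iff not_le intro: gt_ex)
  ultimately show ?thesis
    unfolding overall_sup_def Sup_real_def by simp
qed

lemma measurable_overall_sup [measurable]: "overall_sup W \<in> borel_measurable P"
  unfolding borel_measurable_iff_greater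
proof
  fix y :: real
  let ?N = "{\<omega> \<in> space P. \<not> path_bounded \<omega>}"
  let ?U = "if 0 \<le> y then {\<omega> \<in> space P. \<exists>t\<ge>0. y < W t \<omega>} else space P"
  have "{\<omega> \<in> space P. y < overall_sup W \<omega>} = (?U - ?N) \<union> (if y < Sup UNIV then ?N else {})"
  proof -
    have "y < overall_sup W \<omega> \<longleftrightarrow> \<omega> \<in> ?U" if "\<omega> \<in> space P" "path_bounded \<omega>" for \<omega>
      using that W_0[of \<omega>] by (auto simp: less_overall_sup_iff intro!: exI[of _ 0])
    then have "\<omega> \<in> {\<omega> \<in> space P. y < overall_sup W \<omega>} \<longleftrightarrow>
        \<omega> \<in> (?U - ?N) \<union> (if y < Sup UNIV then ?N else {})" for \<omega>
      using overall_sup_unbounded[of \<omega>] by (cases "\<omega> \<in> space P \<and> path_bounded \<omega>") auto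
    then show ?thesis by (rule set_eqI)
  qed
  also have "\<dots> \<in> events" using sets_path_unbounded sets_exceeds by auto
  finally show "{\<omega> \<in> space P. y < overall_sup W \<omega>} \<in> events" .
qed

text \<open>
  Hitting a level exactly is a closed condition; by compactness it is equivalent to coming arbitrarily close
  at rational times. The time window is enlarged by \<open>1 / (k + 1)\<close> because rational times are only
  guaranteed to the right of the hitting time.
\<close>

lemma hits_level_iff_rational:
  assumes \<omega>: "\<omega> \<in> space P"
  shows "(\<exists>t. 0 \<le> t \<and> t \<le> r \<and> W t \<omega> = l) \<longleftrightarrow>
    (\<forall>k::nat. \<exists>q\<in>{q \<in> \<rat>. 0 \<le> q \<and> q < r + 1 / real (Suc k)}. \<bar>W q \<omega> - l\<bar> < 1 / real (Suc k))"
    (is "?L \<longleftrightarrow> ?R")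
proof
  assume ?L
  then obtain t where t: "0 \<le> t" "t \<le> r" "W t \<omega> = l" by auto
  show ?R
  proof
    fix k :: nat
    have "\<forall>e>0. \<exists>d>0. \<forall>u\<in>{0..}. dist u t < d \<longrightarrow> dist (W u \<omega>) (W t \<omega>) < e"
      using continuous_paths[OF \<omega>] t(1) unfolding continuous_on_iff by auto
    then obtain d where d: "d > 0" "\<And>u. 0 \<le> u \<Longrightarrow> dist u t < d \<Longrightarrow> dist (W u \<omega>) (W t \<omega>) < 1 / real (Suc k)"
      by (metis atLeast_iff of_nat_0_less_iff zero_less_Suc zero_less_divide_1_iff)
    obtain q where q: "q \<in> \<rat>" "t < q" "q < t + min d (1 / real (Suc k))"
      using Rats_dense_in_real[of t "t + min d (1 / real (Suc k))"] d(1) by auto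
    then have "\<bar>W q \<omega> - l\<bar> < 1 / real (Suc k)"
      using d(2)[of q] t by (auto simp: dist_real_def)
    then show "\<exists>q\<in>{q \<in> \<rat>. 0 \<le> q \<and> q < r + 1 / real (Suc k)}. \<bar>W q \<omega> - l\<bar> < 1 / real (Suc k)"
      using q t by (intro bexI[of _ q]) auto
  qed
next
  assume ?R
  then have "\<forall>k::nat. \<exists>q. 0 \<le> q \<and> q < r + 1 / real (Suc k) \<and> \<bar>W q \<omega> - l\<bar> < 1 / real (Suc k)"
    by blast
  then obtain q where q: "\<And>k::nat. 0 \<le> q k" "\<And>k. q k < r + 1 / real (Suc k)"
    "\<And>k. \<bar>W (q k) \<omega> - l\<bar> < 1 / real (Suc k)"
    by metis
  have "q k \<in> {0..r + 1}" for k
  proof -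
    have "1 / real (Suc k) \<le> 1" by simp
    then have "q k \<le> r + 1" using q(2)[of k] by linarith
    then show ?thesis using q(1)[of k] by simp
  qed
  then obtain t \<phi> where t: "t \<in> {0..r + 1}" "strict_mono \<phi>" "(q \<circ> \<phi>) \<longlonglongrightarrow> t"
    using compact_Icc[of 0 "r + 1"] unfolding compact_eq_seq_compact_metric seq_compact_def by metis
  have inv0: "(\<lambda>k. 1 / real (Suc (\<phi> k))) \<longlonglongrightarrow> 0"
    using LIMSEQ_subseq_LIMSEQ[OF lim_1_over_n t(2)] LIMSEQ_subseq_LIMSEQ[OF LIMSEQ_inverse_real_of_nat t(2)]
    by (simp add: o_def inverse_eq_divide)
  have "(\<lambda>k. r + 1 / real (Suc (\<phi> k))) \<longlonglongrightarrow> r + 0"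
    by (intro tendsto_add tendsto_const inv0)
  then have "t \<le> r + 0"
    using q(2) by (intro LIMSEQ_le[OF t(3)]) (auto simp: o_def intro!: exI[of _ 0] less_imp_le)
  have "(\<lambda>k. W (q (\<phi> k)) \<omega>) \<longlonglongrightarrow> W t \<omega>"
    using continuous_paths[OF \<omega>] t q(1)
    by (intro continuous_on_tendsto_compose[where f="\<lambda>t. W t \<omega>" and s="{0..}"]) (auto simp: o_def)
  moreover have "(\<lambda>k. W (q (\<phi> k)) \<omega>) \<longlonglongrightarrow> l"
  proof (rule LIM_zero_cancel, rule tendsto_rabs_zero_cancel, rule tendsto_sandwich[OF _ _ tendsto_const inv0])
    show "\<forall>\<^sub>F k in sequentially. \<bar>W (q (\<phi> k)) \<omega> - l\<bar> \<le> 1 / real (Suc (\<phi> k))"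
      using q(3) by (intro always_eventually allI less_imp_le)
  qed simp
  ultimately have "W t \<omega> = l" by (rule LIMSEQ_unique)
  then show ?L using t(1) \<open>t \<le> r + 0\<close> by auto
qed

lemma sets_sup_attained_by:
  "{\<omega> \<in> space P. \<exists>t. 0 \<le> t \<and> t \<le> r \<and> W t \<omega> = overall_sup W \<omega>} \<in> events"
proof -
  have "{\<omega> \<in> space P. \<exists>t. 0 \<le> t \<and> t \<le> r \<and> W t \<omega> = overall_sup W \<omega>} =
    {\<omega> \<in> space P. \<forall>k::nat. \<exists>q\<in>{q \<in> \<rat>. 0 \<le> q \<and> q < r + 1 / real (Suc k)}.
      \<bar>W q \<omega> - overall_sup W \<omega>\<bar> < 1 / real (Suc k)}"
    by (intro Collect_cong conj_cong refl hits_level_iff_rational)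
  also have "\<dots> \<in> events"
  proof (intro sets.sets_Collect_countable_All)
    fix k :: nat
    show "{\<omega> \<in> space P. \<exists>q\<in>{q \<in> \<rat>. 0 \<le> q \<and> q < r + 1 / real (Suc k)}.
      \<bar>W q \<omega> - overall_sup W \<omega>\<bar> < 1 / real (Suc k)} \<in> events"
    proof (rule sets.sets_Collect_countable_Ex')
      show "countable {q \<in> \<rat>. 0 \<le> q \<and> q < r + 1 / real (Suc k)}"
        by (rule countable_subset[OF _ countable_rat]) auto
      fix q assume "q \<in> {q \<in> \<rat>. 0 \<le> q \<and> q < r + 1 / real (Suc k)}"
      then have [measurable]: "W q \<in> borel_measurable P" using random_variable_W by auto
      show "{\<omega> \<in> space P. \<bar>W q \<omega> - overall_sup W \<omega>\<bar> < 1 / real (Suc k)} \<in> events"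
        by measurable
    qed
  qed
  finally show ?thesis .
qed

lemma sets_sup_attained [measurable]: "{\<omega> \<in> space P. sup_attained \<omega>} \<in> events"
proof -
  have "{\<omega> \<in> space P. sup_attained \<omega>} =
    (\<Union>k::nat. {\<omega> \<in> space P. \<exists>t. 0 \<le> t \<and> t \<le> real k \<and> W t \<omega> = overall_sup W \<omega>})"
    (is "_ = (\<Union>k. ?H k)")
  proof (intro set_eqI iffI)
    fix \<omega> assume "\<omega> \<in> {\<omega> \<in> space P. sup_attained \<omega>}"
    then obtain t where t: "\<omega> \<in> space P" "0 \<le> t" "W t \<omega> = overall_sup W \<omega>" by auto
    obtain k :: nat where "t \<le> real k" using real_arch_simple by blast
    then show "\<omega> \<in> (\<Union>k. ?H k)" using t by auto
  qed auto
  also have "\<dots> \<in> events" by (intro sets.countable_UN) (use sets_sup_attained_by in auto)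
  finally show ?thesis .
qed

lemma argsup_attains:
  assumes "\<omega> \<in> space P" "sup_attained \<omega>"
  shows "0 \<le> argsup W \<omega>" "W (argsup W \<omega>) \<omega> = overall_sup W \<omega>"
proof -
  let ?S = "{t. 0 \<le> t \<and> W t \<omega> = overall_sup W \<omega>}"
  have "closed ({0..} \<inter> (\<lambda>t. W t \<omega>) -` {overall_sup W \<omega>})"
    using continuous_paths[OF assms(1)] by (intro continuous_closed_preimage) auto
  also have "{0..} \<inter> (\<lambda>t. W t \<omega>) -` {overall_sup W \<omega>} = ?S" by auto
  finally have "closed ?S" .
  moreover have "?S \<noteq> {}" using assms(2) by auto
  moreover have "bdd_below ?S" by (rule bdd_belowI[of _ 0]) auto
  ultimately have "argsup W \<omega> \<in> ?S"
    unfolding argsup_def by (rule closed_contains_Inf[rotated 2])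
  then show "0 \<le> argsup W \<omega>" "W (argsup W \<omega>) \<omega> = overall_sup W \<omega>" by auto
qed

lemma argsup_le: "0 \<le> t \<Longrightarrow> W t \<omega> = overall_sup W \<omega> \<Longrightarrow> argsup W \<omega> \<le> t"
  unfolding argsup_def by (intro cInf_lower bdd_belowI[of _ 0]) auto

lemma measurable_argsup [measurable]: "argsup W \<in> borel_measurable P"
  unfolding borel_measurable_iff_le
proof
  fix r :: real
  let ?H = "{\<omega> \<in> space P. \<exists>t. 0 \<le> t \<and> t \<le> r \<and> W t \<omega> = overall_sup W \<omega>}"
  let ?A = "{\<omega> \<in> space P. sup_attained \<omega>}"
  have "{\<omega> \<in> space P. argsup W \<omega> \<le> r} = ?H \<union> (if Inf {} \<le> r then space P - ?A else {})"
  proof -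
    have "argsup W \<omega> \<le> r \<longleftrightarrow> \<omega> \<in> ?H" if "\<omega> \<in> space P" "sup_attained \<omega>" for \<omega>
      using that argsup_attains[OF that] argsup_le[of _ \<omega>] by (auto intro: order.trans)
    moreover have "argsup W \<omega> = Inf {}" if "\<not> sup_attained \<omega>" for \<omega>
      unfolding argsup_def using that by (intro arg_cong[where f=Inf]) auto
    ultimately have "\<omega> \<in> {\<omega> \<in> space P. argsup W \<omega> \<le> r} \<longleftrightarrow>
        \<omega> \<in> ?H \<union> (if Inf {} \<le> r then space P - ?A else {})" for \<omega>
      by (cases "\<omega> \<in> space P \<and> sup_attained \<omega>") auto
    then show ?thesis by (rule set_eqI)
  qed
  also have "\<dots> \<in> events" using sets_sup_attained_by sets_sup_attained by auto
  finally show "{\<omega> \<in> space P. argsup W \<omega> \<le> r} \<in> events" .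
qed

end

section \<open>Slicing by the level of the supremum\<close>

lemma sum_geometric_differences:
  fixes q p :: real
  assumes "q \<noteq> 1"
  shows "(\<Sum>j<n. q ^ j * (1 - p)) = (1 - p) * ((1 - q ^ n) / (1 - q))"
  using assms by (simp add: sum_distrib_right[symmetric] sum_gp_strict)

text \<open>
  Exactly one slice contains \<open>l\<close>; all the other terms vanish.
\<close>

lemma sum_consecutive_level_indicator:
  fixes g :: "nat \<Rightarrow> real" and l \<epsilon> :: real
  assumes "0 < \<epsilon>" "real j * \<epsilon> < l" "l \<le> real (Suc j) * \<epsilon>" "j < N"
  shows "(\<Sum>i<N. g i * (of_bool (real i * \<epsilon> < l) - of_bool (real (Suc i) * \<epsilon> < l))) = g j"
proof -
  have slice: "of_bool (real i * \<epsilon> < l) - of_bool (real (Suc i) * \<epsilon> < l) = (if i = j then 1 else 0 :: real)" for i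
  proof -
    consider "i < j" | "i = j" | "j < i" by linarith
    then show ?thesis
    proof cases
      case 1
      then have "real i * \<epsilon> \<le> real j * \<epsilon>" "real (Suc i) * \<epsilon> \<le> real j * \<epsilon>"
        using assms(1) by (auto intro!: mult_right_mono simp del: of_nat_Suc)
      then have "real i * \<epsilon> < l" "real (Suc i) * \<epsilon> < l" using assms(2) by linarith+
      then show ?thesis using 1 by (simp del: of_nat_Suc)
    next
      case 2
      then show ?thesis using assms by (simp del: of_nat_Suc)
    next
      case 3
      then have "real (Suc j) * \<epsilon> \<le> real i * \<epsilon>" "real (Suc j) * \<epsilon> \<le> real (Suc i) * \<epsilon>"
        using assms(1) by (auto intro!: mult_right_mono simp del: of_nat_Suc)
      then have "\<not> real i * \<epsilon> < l" "\<not> real (Suc i) * \<epsilon> < l" using assms(3) by linarith+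
      then show ?thesis using 3 by (simp del: of_nat_Suc)
    qed
  qed
  show ?thesis unfolding slice using assms(4) by (simp add: if_distrib cong: if_cong)
qed

lemma level_index:
  fixes l \<epsilon> :: real
  assumes "0 < l" "0 < \<epsilon>"
  obtains j :: nat where "real j * \<epsilon> < l" "l \<le> real (Suc j) * \<epsilon>"
proof
  let ?j = "nat (\<lceil>l / \<epsilon>\<rceil> - 1)"
  have "0 < l / \<epsilon>" using assms by simp
  then have "0 \<le> \<lceil>l / \<epsilon>\<rceil> - 1" by simp
  then have j: "real ?j = of_int \<lceil>l / \<epsilon>\<rceil> - 1" by simp
  have "real ?j < l / \<epsilon>" "l / \<epsilon> \<le> real (Suc ?j)" unfolding of_nat_Suc j by linarith+
  then show "real ?j * \<epsilon> < l" "l \<le> real (Suc ?j) * \<epsilon>"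
    using assms(2) by (simp_all add: pos_less_divide_eq pos_divide_le_eq del: of_nat_Suc)
qed

context negatively_drifted_brownian_motion
begin

lemma passage_below_sup:
  assumes "path_bounded \<omega>"
  shows "passage a x y \<omega> = of_bool (y < overall_sup W \<omega>) * exp (- a * first_passage x \<omega>)"
  unfolding passage_def less_overall_sup_iff[OF assms] by simp

text \<open>
  On a compact interval without a maximiser the path stays below a level strictly smaller than the
  supremum, so higher levels are passed only later.
\<close>

lemma first_passage_ge_below_sup:
  assumes \<omega>: "\<omega> \<in> space P" and bounded: "path_bounded \<omega>" and "0 \<le> s"
    and below: "\<And>t. 0 \<le> t \<Longrightarrow> t \<le> s \<Longrightarrow> W t \<omega> \<noteq> overall_sup W \<omega>"
  obtains m where "m < overall_sup W \<omega>"
    "\<And>x. m < x \<Longrightarrow> x < overall_sup W \<omega> \<Longrightarrow> s \<le> first_passage x \<omega>"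
proof -
  have "continuous_on {0..s} (\<lambda>t. W t \<omega>)"
    using continuous_paths[OF \<omega>] by (rule continuous_on_subset) auto
  then obtain u where u: "u \<in> {0..s}" "\<forall>t\<in>{0..s}. W t \<omega> \<le> W u \<omega>"
    using continuous_attains_sup[of "{0..s}" "\<lambda>t. W t \<omega>"] \<open>0 \<le> s\<close> by auto
  show thesis
  proof (rule that[of "W u \<omega>"])
    show "W u \<omega> < overall_sup W \<omega>"
      using le_overall_sup[OF bounded, of u] below[of u] u(1) by fastforce
    fix x assume x: "W u \<omega> < x" "x < overall_sup W \<omega>"
    then have ex: "\<exists>t\<ge>0. x < W t \<omega>" using less_overall_sup_iff[OF bounded] by simp
    show "s \<le> first_passage x \<omega>"
      unfolding first_passage_def
    proof (rule cInf_greatest)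
      show "{t. 0 \<le> t \<and> x < W t \<omega>} \<noteq> {}" using ex by auto
      fix t assume "t \<in> {t. 0 \<le> t \<and> x < W t \<omega>}"
      then show "s \<le> t" using u(2) x(1) by (metis (no_types, lifting) atLeastAtMost_iff leD le_less_linear
            less_imp_le mem_Collect_eq order.strict_trans)
    qed
  qed
qed

text \<open>
  As levels increase to the supremum, their passage times increase to the first maximiser, or to infinity
  if there is none. In the latter case the limit is 0 because \<open>a\<close> is positive.
\<close>

lemma exp_first_passage_tendsto:
  assumes \<omega>: "\<omega> \<in> space P" and bounded: "path_bounded \<omega>" and "0 < a"
    and x: "\<forall>\<^sub>F k in sequentially. x k < overall_sup W \<omega>" "x \<longlonglongrightarrow> overall_sup W \<omega>"
  shows "(\<lambda>k. exp (- a * first_passage (x k) \<omega>)) \<longlonglongrightarrow>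
    of_bool (sup_attained \<omega>) * exp (- a * argsup W \<omega>)"
proof -
  have late: "\<forall>\<^sub>F k in sequentially. s \<le> first_passage (x k) \<omega>"
    if s: "0 \<le> s" "\<And>t. 0 \<le> t \<Longrightarrow> t \<le> s \<Longrightarrow> W t \<omega> \<noteq> overall_sup W \<omega>" for s
  proof -
    obtain m where m: "m < overall_sup W \<omega>"
      "\<And>z. m < z \<Longrightarrow> z < overall_sup W \<omega> \<Longrightarrow> s \<le> first_passage z \<omega>"
      using first_passage_ge_below_sup[OF \<omega> bounded s] by blast
    from x(1) order_tendstoD(1)[OF x(2) m(1)] show ?thesis
      by eventually_elim (rule m(2))
  qed
  show ?thesis
  proof (cases "sup_attained \<omega>")
    case True
    note \<sigma> = argsup_attains[OF \<omega> True]
    have "(\<lambda>k. first_passage (x k) \<omega>) \<longlonglongrightarrow> argsup W \<omega>"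
    proof (rule order_tendstoI)
      fix l assume l: "l < argsup W \<omega>"
      show "\<forall>\<^sub>F k in sequentially. l < first_passage (x k) \<omega>"
      proof (cases "argsup W \<omega> = 0")
        case True
        have "0 \<le> first_passage (x k) \<omega>" if "x k < overall_sup W \<omega>" for k
          using that less_overall_sup_iff[OF bounded] by (intro first_passage_nonneg) simp
        then have "l < first_passage (x k) \<omega>" if "x k < overall_sup W \<omega>" for k
          using that l True by fastforce
        with x(1) show ?thesis by (rule eventually_mono)
      next
        case False
        obtain s where s: "max 0 l < s" "s < argsup W \<omega>"
          using dense[of "max 0 l" "argsup W \<omega>"] False l \<sigma>(1) by auto
        have "\<forall>\<^sub>F k in sequentially. s \<le> first_passage (x k) \<omega>"
          using s argsup_le[of _ \<omega>] by (intro late) fastforce+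
        then show ?thesis by (rule eventually_mono) (use s in simp)
      qed
    next
      fix u assume u: "argsup W \<omega> < u"
      have "first_passage (x k) \<omega> < u" if "x k < overall_sup W \<omega>" for k
        using first_passage_le[OF \<sigma>(1), of "x k" \<omega>] \<sigma>(2) that u by simp
      with x(1) show "\<forall>\<^sub>F k in sequentially. first_passage (x k) \<omega> < u"
        by (rule eventually_mono)
    qed
    then show ?thesis using True by (auto intro!: tendsto_intros)
  next
    case False
    have "filterlim (\<lambda>k. first_passage (x k) \<omega>) at_top sequentially"
      unfolding filterlim_at_top
    proof
      fix z :: real
      have "\<forall>\<^sub>F k in sequentially. max 0 z \<le> first_passage (x k) \<omega>"
        using False by (intro late) auto
      then show "\<forall>\<^sub>F k in sequentially. z \<le> first_passage (x k) \<omega>"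
        by (rule eventually_mono) simp
    qed
    then have "filterlim (\<lambda>k. - a * first_passage (x k) \<omega>) at_bot sequentially"
      using \<open>0 < a\<close> by (intro filterlim_tendsto_neg_mult_at_bot[OF tendsto_const]) simp_all
    then have "(\<lambda>k. exp (- a * first_passage (x k) \<omega>)) \<longlonglongrightarrow> 0"
      by (rule filterlim_compose[OF exp_at_bot])
    then show ?thesis unfolding of_bool_def if_not_P[OF False] mult_zero_left .
  qed
qed

text \<open>
  The slice \<open>j / n < M \<le> (j + 1) / n\<close> contributes \<open>exp (- b x - a T\<^sub>x)\<close> at its lower end \<open>x = j / n\<close>. Taking
  \<open>n\<^sup>2\<close> slices of width \<open>1 / n\<close> refines the mesh and raises the highest level at the same time.
\<close>

definition level_slices :: "real \<Rightarrow> real \<Rightarrow> nat \<Rightarrow> 'a \<Rightarrow> real" where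
  "level_slices a b n \<omega> = (\<Sum>j<n\<^sup>2. exp (- b * (real j * (1 / real n))) *
    (passage a (real j * (1 / real n)) (real j * (1 / real n)) \<omega> -
     passage a (real j * (1 / real n)) (real (Suc j) * (1 / real n)) \<omega>))"

lemma level_slices_expand:
  assumes "path_bounded \<omega>"
  shows "level_slices a b n \<omega> = (\<Sum>j<n\<^sup>2.
    exp (- b * (real j * (1 / real n))) * exp (- a * first_passage (real j * (1 / real n)) \<omega>) *
      (of_bool (real j * (1 / real n) < overall_sup W \<omega>) -
       of_bool (real (Suc j) * (1 / real n) < overall_sup W \<omega>)))"
proof -
  have factor: "e * (p * z - q * z) = e * z * (p - q)" for e p q z :: real
    by (simp add: algebra_simps)
  show ?thesis
    unfolding level_slices_def passage_below_sup[OF assms] by (intro sum.cong refl factor)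
qed

lemma level_slices_eq:
  assumes bounded: "path_bounded \<omega>" and "0 < n" "real j * (1 / real n) < overall_sup W \<omega>"
    "overall_sup W \<omega> \<le> real (Suc j) * (1 / real n)" "j < n\<^sup>2"
  shows "level_slices a b n \<omega> =
    exp (- b * (real j * (1 / real n))) * exp (- a * first_passage (real j * (1 / real n)) \<omega>)"
proof -
  have "0 < 1 / real n" using assms(2) by simp
  then show ?thesis
    unfolding level_slices_expand[OF bounded] by (rule sum_consecutive_level_indicator[OF _ assms(3-5)])
qed

lemma level_slices_tendsto:
  assumes \<omega>: "\<omega> \<in> space P" and bounded: "path_bounded \<omega>" and "\<exists>t\<ge>0. 0 < W t \<omega>" and "0 < a"
  shows "(\<lambda>k. level_slices a b (Suc k) \<omega>) \<longlonglongrightarrow>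
    of_bool (sup_attained \<omega>) * exp (- a * argsup W \<omega> - b * overall_sup W \<omega>)"
proof -
  let ?M = "overall_sup W \<omega>"
  have M_pos: "0 < ?M" using assms(3) less_overall_sup_iff[OF bounded] by simp
  have "\<exists>j::nat. real j * (1 / real (Suc k)) < ?M \<and> ?M \<le> real (Suc j) * (1 / real (Suc k))" for k
  proof -
    have "0 < 1 / real (Suc k)" by simp
    from level_index[OF M_pos this] show ?thesis by metis
  qed
  then obtain j where j: "\<And>k. real (j k) * (1 / real (Suc k)) < ?M"
    "\<And>k. ?M \<le> real (Suc (j k)) * (1 / real (Suc k))" by metis
  define x where "x k = real (j k) * (1 / real (Suc k))" for k
  have "(\<lambda>k. ?M - 1 / real (Suc k)) \<longlonglongrightarrow> ?M - 0"
    by (intro tendsto_diff tendsto_const) real_asymp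
  moreover have "?M - 1 / real (Suc k) \<le> x k" "x k \<le> ?M" for k
  proof -
    have "real (Suc (j k)) * (1 / real (Suc k)) = x k + 1 / real (Suc k)"
      by (simp add: x_def add_divide_distrib)
    then show "?M - 1 / real (Suc k) \<le> x k" "x k \<le> ?M"
      using j(1)[of k] j(2)[of k] unfolding x_def by linarith+
  qed
  ultimately have x_lim: "x \<longlonglongrightarrow> ?M"
    using tendsto_sandwich[where f="\<lambda>k. ?M - 1 / real (Suc k)" and g=x and h="\<lambda>_. ?M",
        OF always_eventually always_eventually _ tendsto_const] by simp
  have "(\<lambda>k. exp (- b * x k) * exp (- a * first_passage (x k) \<omega>)) \<longlonglongrightarrow>
     exp (- b * ?M) * (of_bool (sup_attained \<omega>) * exp (- a * argsup W \<omega>))"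
    by (intro tendsto_intros exp_first_passage_tendsto[OF \<omega> bounded \<open>0 < a\<close>] x_lim)
      (unfold x_def, intro always_eventually allI j(1))
  also have "exp (- b * ?M) * (of_bool (sup_attained \<omega>) * exp (- a * argsup W \<omega>)) =
     of_bool (sup_attained \<omega>) * exp (- a * argsup W \<omega> - b * ?M)"
    by (simp add: mult.left_commute exp_add[symmetric])
  finally have lim: "(\<lambda>k. exp (- b * x k) * exp (- a * first_passage (x k) \<omega>)) \<longlonglongrightarrow>
     of_bool (sup_attained \<omega>) * exp (- a * argsup W \<omega> - b * ?M)" .
  obtain N :: nat where N: "?M \<le> real N" using real_arch_simple by blast
  have "\<forall>\<^sub>F k in sequentially. ?M \<le> real (Suc k)"
    using eventually_ge_at_top[of N]
    by (rule eventually_mono) (use N in simp)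
  then have "\<forall>\<^sub>F k in sequentially. exp (- b * x k) * exp (- a * first_passage (x k) \<omega>) = level_slices a b (Suc k) \<omega>"
  proof eventually_elim
    case (elim k)
    have "real (j k) < ?M * real (Suc k)"
      using j(1)[of k] by (simp add: pos_divide_less_eq del: of_nat_Suc)
    also have "\<dots> \<le> real (Suc k) * real (Suc k)" using elim by (intro mult_right_mono) auto
    finally have "real (j k) < real ((Suc k)\<^sup>2)" unfolding power2_eq_square of_nat_mult .
    then have "j k < (Suc k)\<^sup>2" by (simp only: of_nat_less_iff)
    then show ?case
      using level_slices_eq[OF bounded _ j(1)[of k] j(2)[of k]] by (simp add: x_def del: of_nat_Suc)
  qed
  with lim show ?thesis by (rule Lim_transform_eventually)
qed

lemma level_slices_bounded:
  assumes "path_bounded \<omega>" "0 \<le> a" "0 \<le> b" "0 < n"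
  shows "\<bar>level_slices a b n \<omega>\<bar> \<le> 1"
proof -
  let ?M = "overall_sup W \<omega>" and ?\<epsilon> = "1 / real n"
  have expand: "level_slices a b n \<omega> = (\<Sum>j<n\<^sup>2. exp (- b * (real j * ?\<epsilon>)) * exp (- a * first_passage (real j * ?\<epsilon>) \<omega>) *
      (of_bool (real j * ?\<epsilon> < ?M) - of_bool (real (Suc j) * ?\<epsilon> < ?M)))"
    by (rule level_slices_expand[OF assms(1)])
  have step: "real j * ?\<epsilon> \<le> real (Suc j) * ?\<epsilon>" for j by (intro mult_right_mono) auto
  have nonneg: "(0::real) \<le> of_bool (real j * ?\<epsilon> < ?M) - of_bool (real (Suc j) * ?\<epsilon> < ?M)" for j
    using step[of j] by (auto simp del: of_nat_Suc)
  have le: "exp (- b * (real j * ?\<epsilon>)) * exp (- a * first_passage (real j * ?\<epsilon>) \<omega>) *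
      (of_bool (real j * ?\<epsilon> < ?M) - of_bool (real (Suc j) * ?\<epsilon> < ?M))
      \<le> of_bool (real j * ?\<epsilon> < ?M) - of_bool (real (Suc j) * ?\<epsilon> < ?M)" for j
  proof (cases "real j * ?\<epsilon> < ?M")
    case True
    then have "0 \<le> first_passage (real j * ?\<epsilon>) \<omega>"
      using less_overall_sup_iff[OF assms(1)] by (intro first_passage_nonneg) blast
    then have "exp (- b * (real j * ?\<epsilon>)) * exp (- a * first_passage (real j * ?\<epsilon>) \<omega>) \<le> 1"
      using assms by (intro mult_le_one) auto
    then show ?thesis using nonneg[of j] by (metis mult_left_le_one_le mult_nonneg_nonneg exp_ge_zero)
  next
    case False
    then show ?thesis using step[of j] by (simp del: of_nat_Suc)
  qed
  have "level_slices a b n \<omega> \<le> (\<Sum>j<n\<^sup>2. of_bool (real j * ?\<epsilon> < ?M) - of_bool (real (Suc j) * ?\<epsilon> < ?M))"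
    unfolding expand by (intro sum_mono le)
  also have "\<dots> = of_bool (real 0 * ?\<epsilon> < ?M) - of_bool (real (n\<^sup>2) * ?\<epsilon> < ?M)"
    using sum_lessThan_telescope'[of "\<lambda>j. of_bool (real j * ?\<epsilon> < ?M) :: real" "n\<^sup>2"] by simp
  also have "\<dots> \<le> 1" by simp
  finally have "level_slices a b n \<omega> \<le> 1" .
  moreover have "0 \<le> level_slices a b n \<omega>"
    unfolding expand by (intro sum_nonneg mult_nonneg_nonneg nonneg) auto
  ultimately show ?thesis by simp
qed

lemma integrable_passage:
  assumes "\<delta> \<le> \<theta>" "a = \<theta> * (\<theta> - \<delta>) / 2" "0 \<le> x" "x \<le> y"
  shows "integrable P (passage a x y)"
proof (rule integrable_const_bound[where B=1])
  have a0: "0 \<le> a" unfolding assms(2) using assms(1) \<delta>_pos by simp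
  have "norm (passage a x y \<omega>) \<le> 1" for \<omega>
  proof (cases "\<exists>t\<ge>0. y < W t \<omega>")
    case True
    then have "0 \<le> first_passage x \<omega>" using assms(4) by (intro first_passage_nonneg) force
    then show ?thesis using a0 by (simp add: passage_def)
  next
    case False
    then show ?thesis unfolding passage_def if_not_P[OF False] by simp
  qed
  then show "AE \<omega> in P. norm (passage a x y \<omega>) \<le> 1" by simp
qed (use measurable_passage assms in blast)

lemma expectation_level_slices:
  assumes \<theta>: "\<delta> \<le> \<theta>" "a = \<theta> * (\<theta> - \<delta>) / 2" and "0 \<le> b" "0 < n"
  shows "level_slices a b n \<in> borel_measurable P"
    and "expectation (level_slices a b n) =
      (1 - exp (- \<delta> / real n)) * ((1 - exp (- (b + \<theta>) * real n)) / (1 - exp (- (b + \<theta>) / real n)))"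
proof -
  note int = integrable_passage[OF \<theta>]
  define u where "u j = real j * (1 / real n)" for j
  have u0: "0 \<le> u j" and u_Suc: "u j \<le> u (Suc j)" for j
    by (simp_all add: u_def divide_right_mono)
  have slices: "level_slices a b n = (\<lambda>\<omega>. \<Sum>j<n\<^sup>2. exp (- b * u j) *
      (passage a (u j) (u j) \<omega> - passage a (u j) (u (Suc j)) \<omega>))"
    unfolding level_slices_def u_def ..
  show "level_slices a b n \<in> borel_measurable P"
    unfolding slices
    by (intro borel_measurable_sum borel_measurable_times borel_measurable_diff borel_measurable_const
        borel_measurable_integrable int u0 u_Suc order.refl)
  have "expectation (level_slices a b n) = (\<Sum>j<n\<^sup>2. exp (- b * u j) *
     (expectation (passage a (u j) (u j)) - expectation (passage a (u j) (u (Suc j)))))"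
    unfolding slices using int[OF u0 order.refl] int[OF u0 u_Suc]
    by (simp add: Bochner_Integration.integral_sum Bochner_Integration.integral_diff)
  also have "\<dots> = (\<Sum>j<n\<^sup>2. exp (- (b + \<theta>) / real n) ^ j * (1 - exp (- \<delta> / real n)))"
  proof (rule sum.cong[OF refl])
    fix j
    have "exp (- (b + \<theta>) / real n) ^ j = exp (- b * u j) * exp (- \<theta> * u j)"
      by (simp add: u_def exp_of_nat_mult[symmetric] exp_add[symmetric] algebra_simps
          add_divide_distrib diff_divide_distrib)
    moreover have "u (Suc j) - u j = 1 / real n"
      by (simp add: u_def add_divide_distrib)
    then have "exp (- \<theta> * u j - \<delta> * (u (Suc j) - u j)) = exp (- \<theta> * u j) * exp (- \<delta> / real n)"
      by (simp add: exp_add[symmetric])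
    ultimately show "exp (- b * u j) * (expectation (passage a (u j) (u j)) - expectation (passage a (u j) (u (Suc j)))) =
      exp (- (b + \<theta>) / real n) ^ j * (1 - exp (- \<delta> / real n))"
      unfolding expectation_passage[OF \<theta> u0 order.refl] expectation_passage[OF \<theta> u0 u_Suc]
      by (simp add: right_diff_distrib)
  qed
  also have "\<dots> = (1 - exp (- \<delta> / real n)) *
     ((1 - exp (- (b + \<theta>) / real n) ^ (n\<^sup>2)) / (1 - exp (- (b + \<theta>) / real n)))"
    using assms \<delta>_pos by (intro sum_geometric_differences) auto
  also have "exp (- (b + \<theta>) / real n) ^ (n\<^sup>2) = exp (- (b + \<theta>) * real n)"
    using assms(4) by (simp add: exp_of_nat_mult[symmetric] power2_eq_square)
  finally show "expectation (level_slices a b n) =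
      (1 - exp (- \<delta> / real n)) * ((1 - exp (- (b + \<theta>) * real n)) / (1 - exp (- (b + \<theta>) / real n)))"
    by simp
qed

lemma laplace_on_attained:
  assumes \<theta>: "\<delta> < \<theta>" "a = \<theta> * (\<theta> - \<delta>) / 2" and "0 \<le> b"
  shows "expectation (\<lambda>\<omega>. of_bool (sup_attained \<omega>) * exp (- a * argsup W \<omega> - b * overall_sup W \<omega>)) =
    \<delta> / (b + \<theta>)"
proof -
  have \<theta>': "\<delta> \<le> \<theta>" using \<theta> by simp
  have a0: "0 < a" unfolding \<theta>(2) using \<theta>(1) \<delta>_pos by simp
  note slices = expectation_level_slices[OF \<theta>' \<theta>(2) \<open>0 \<le> b\<close>]
  have "(\<lambda>k. expectation (level_slices a b (Suc k))) \<longlonglongrightarrow>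
     expectation (\<lambda>\<omega>. of_bool (sup_attained \<omega>) * exp (- a * argsup W \<omega> - b * overall_sup W \<omega>))"
  proof (rule integral_dominated_convergence[where w="\<lambda>_. 1"])
    have "(\<lambda>\<omega>. of_bool (sup_attained \<omega>) :: real) \<in> borel_measurable P"
      by measurable
    then show "(\<lambda>\<omega>. of_bool (sup_attained \<omega>) * exp (- a * argsup W \<omega> - b * overall_sup W \<omega>)) \<in> borel_measurable P"
      by measurable
    show "AE \<omega> in P. (\<lambda>k. level_slices a b (Suc k) \<omega>) \<longlonglongrightarrow>
        of_bool (sup_attained \<omega>) * exp (- a * argsup W \<omega> - b * overall_sup W \<omega>)"
      using AE_path_bounded AE_exceeds_0 AE_space
      by eventually_elim (intro level_slices_tendsto a0)
    show "AE \<omega> in P. norm (level_slices a b (Suc k) \<omega>) \<le> 1" for k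
      using AE_path_bounded
      by eventually_elim (use a0 \<open>0 \<le> b\<close> in \<open>auto intro!: level_slices_bounded\<close>)
  qed (use slices in simp_all)
  moreover have "(\<lambda>k. expectation (level_slices a b (Suc k))) \<longlonglongrightarrow> \<delta> / (b + \<theta>)"
  proof -
    have pos: "0 < b + \<theta>" using \<open>0 \<le> b\<close> \<theta> \<delta>_pos by simp
    have "(\<lambda>k. (1 - exp (- \<delta> / real (Suc k))) * ((1 - exp (- c * real (Suc k))) / (1 - exp (- c / real (Suc k)))))
       \<longlonglongrightarrow> \<delta> / c" if "0 < c" for c
      using that \<delta>_pos by real_asymp (simp add: divide_inverse)
    from this[OF pos] show ?thesis using slices(2) by simp
  qed
  ultimately show ?thesis by (rule LIMSEQ_unique)
qed

text \<open>
  With \<open>b = 0\<close>, the expectation \<open>\<delta> / \<theta>\<close> tends to 1 as \<open>a\<close> decreases to 0, while the integrand tends to the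
  indicator of the event that the supremum is attained.
\<close>

lemma AE_sup_attained: "AE \<omega> in P. sup_attained \<omega>"
proof -
  define \<theta> where "\<theta> k = \<delta> + 1 / real (Suc k)" for k
  define a where "a k = \<theta> k * (\<theta> k - \<delta>) / 2" for k
  have \<theta>: "\<delta> < \<theta> k" for k by (simp add: \<theta>_def)
  have a0: "0 < a k" for k unfolding a_def using \<theta>[of k] \<delta>_pos by simp
  have meas: "(\<lambda>\<omega>. of_bool (sup_attained \<omega>) :: real) \<in> borel_measurable P"
    by measurable
  have "(\<lambda>k. expectation (\<lambda>\<omega>. of_bool (sup_attained \<omega>) * exp (- a k * argsup W \<omega> - 0 * overall_sup W \<omega>)))
     \<longlonglongrightarrow> expectation (\<lambda>\<omega>. of_bool (sup_attained \<omega>))"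
  proof (rule integral_dominated_convergence[where w="\<lambda>_. 1"])
    have "a \<longlonglongrightarrow> 0" unfolding a_def \<theta>_def using \<delta>_pos by real_asymp
    then have "(\<lambda>k. of_bool (sup_attained \<omega>) * exp (- a k * argsup W \<omega> - 0 * overall_sup W \<omega>)) \<longlonglongrightarrow>
       of_bool (sup_attained \<omega>) * exp (- 0 * argsup W \<omega> - 0 * overall_sup W \<omega>)" for \<omega>
      by (intro tendsto_intros)
    then show "AE \<omega> in P. (\<lambda>k. of_bool (sup_attained \<omega>) * exp (- a k * argsup W \<omega> - 0 * overall_sup W \<omega>)) \<longlonglongrightarrow>
       of_bool (sup_attained \<omega>)" by simp
    show "AE \<omega> in P. norm (of_bool (sup_attained \<omega>) * exp (- a k * argsup W \<omega> - 0 * overall_sup W \<omega>)) \<le> (1::real)" for k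
      using AE_space
    proof eventually_elim
      case (elim \<omega>)
      show ?case
      proof (cases "sup_attained \<omega>")
        case True
        then show ?thesis using argsup_attains(1)[OF elim] a0[of k] by simp
      next
        case False
        show ?thesis unfolding of_bool_def if_not_P[OF False] by simp
      qed
    qed
    show "(\<lambda>\<omega>. of_bool (sup_attained \<omega>) * exp (- a k * argsup W \<omega> - 0 * overall_sup W \<omega>)) \<in> borel_measurable P" for k
      using meas by measurable
  qed (use meas in simp_all)
  moreover have "(\<lambda>k. \<delta> / (0 + \<theta> k)) \<longlonglongrightarrow> 1"
    unfolding \<theta>_def using \<delta>_pos by real_asymp
  ultimately have "expectation (\<lambda>\<omega>. of_bool (sup_attained \<omega>)) = (1::real)"
    unfolding laplace_on_attained[OF \<theta> a_def order.refl] by (rule LIMSEQ_unique)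
  moreover have "expectation (\<lambda>\<omega>. of_bool (sup_attained \<omega>)) = prob {\<omega> \<in> space P. sup_attained \<omega>}"
  proof -
    have "expectation (\<lambda>\<omega>. of_bool (sup_attained \<omega>)) =
        expectation (indicator {\<omega> \<in> space P. sup_attained \<omega>} :: 'a \<Rightarrow> real)"
      by (intro Bochner_Integration.integral_cong) (auto simp: indicator_def)
    then show ?thesis using sets_sup_attained by simp
  qed
  ultimately have "AE \<omega> in P. \<omega> \<in> {\<omega> \<in> space P. sup_attained \<omega>}"
    using sets_sup_attained by (subst AE_in_set_eq_1) auto
  then show ?thesis by (auto elim!: AE_mp)
qed

lemma AE_sup_nonneg: "AE \<omega> in P. 0 \<le> argsup W \<omega> \<and> 0 \<le> overall_sup W \<omega>"
  using AE_sup_attained AE_path_bounded AE_space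
proof eventually_elim
  case (elim \<omega>)
  then show ?case using argsup_attains[of \<omega>] le_overall_sup[of \<omega> 0] W_0[of \<omega>] by simp
qed


text \<open>
  The case \<open>a = 0\<close>, which is the law of the supremum alone, follows from \<open>a > 0\<close> by dominated
  convergence: for \<open>a = 0\<close> the factor \<open>exp (- a T\<^sub>x)\<close> does not vanish in the limit on paths that fail to
  attain their supremum, so the slicing argument does not cover it directly.
\<close>

lemma laplace_argsup_sup:
  assumes "0 \<le> a" "0 \<le> b"
  shows "expectation (\<lambda>\<omega>. exp (- a * argsup W \<omega> - b * overall_sup W \<omega>)) =
    \<delta> / (b + (\<delta> + sqrt (\<delta>\<^sup>2 + 8 * a)) / 2)"
proof -
  have pos: "expectation (\<lambda>\<omega>. exp (- a * argsup W \<omega> - b * overall_sup W \<omega>)) =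
    \<delta> / (b + (\<delta> + sqrt (\<delta>\<^sup>2 + 8 * a)) / 2)" if "0 < a" for a
  proof -
    define q \<theta> where "q = sqrt (\<delta>\<^sup>2 + 8 * a)" and "\<theta> = (\<delta> + q) / 2"
    have q2: "q\<^sup>2 = \<delta>\<^sup>2 + 8 * a" using that by (simp add: q_def)
    have "sqrt (\<delta>\<^sup>2) < q" unfolding q_def using that by (intro real_sqrt_less_mono) simp
    then have "\<delta> < q" using \<delta>_pos by simp
    then have \<theta>: "\<delta> < \<theta>" by (simp add: \<theta>_def)
    have "a = \<theta> * (\<theta> - \<delta>) / 2"
      using q2 by (simp add: \<theta>_def field_simps power2_eq_square)
    from laplace_on_attained[OF \<theta> this \<open>0 \<le> b\<close>]
    have "expectation (\<lambda>\<omega>. of_bool (sup_attained \<omega>) * exp (- a * argsup W \<omega> - b * overall_sup W \<omega>)) =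
      \<delta> / (b + \<theta>)" .
    moreover have "(\<lambda>\<omega>. of_bool (sup_attained \<omega>) :: real) \<in> borel_measurable P"
      by measurable
    then have "expectation (\<lambda>\<omega>. of_bool (sup_attained \<omega>) * exp (- a * argsup W \<omega> - b * overall_sup W \<omega>)) =
      expectation (\<lambda>\<omega>. exp (- a * argsup W \<omega> - b * overall_sup W \<omega>))"
      using AE_sup_attained by (intro integral_cong_AE) (auto elim!: eventually_mono)
    ultimately show ?thesis by (simp add: \<theta>_def q_def)
  qed
  show ?thesis
  proof (cases "a = 0")
    case False
    then show ?thesis using pos assms by simp
  next
    case True
    have inv_pos: "0 < 1 / real (Suc k)" for k by simp
    have "(\<lambda>k. expectation (\<lambda>\<omega>. exp (- (1 / real (Suc k)) * argsup W \<omega> - b * overall_sup W \<omega>)))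
       \<longlonglongrightarrow> expectation (\<lambda>\<omega>. exp (- 0 * argsup W \<omega> - b * overall_sup W \<omega>))"
    proof (rule integral_dominated_convergence[where w="\<lambda>_. 1"])
      have "(\<lambda>k. 1 / real (Suc k)) \<longlonglongrightarrow> 0" by real_asymp
      then have "(\<lambda>k. exp (- (1 / real (Suc k)) * argsup W \<omega> - b * overall_sup W \<omega>)) \<longlonglongrightarrow>
          exp (- 0 * argsup W \<omega> - b * overall_sup W \<omega>)" for \<omega>
        by (intro tendsto_intros)
      then show "AE \<omega> in P. (\<lambda>k. exp (- (1 / real (Suc k)) * argsup W \<omega> - b * overall_sup W \<omega>)) \<longlonglongrightarrow>
          exp (- 0 * argsup W \<omega> - b * overall_sup W \<omega>)" by simp
      show "AE \<omega> in P. norm (exp (- (1 / real (Suc k)) * argsup W \<omega> - b * overall_sup W \<omega>)) \<le> 1" for k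
        using AE_sup_nonneg
      proof eventually_elim
        case (elim \<omega>)
        then have "0 \<le> 1 / real (Suc k) * argsup W \<omega>" "0 \<le> b * overall_sup W \<omega>"
          using assms by simp_all
        then show ?case by simp
      qed
    qed simp_all
    then have "(\<lambda>k. \<delta> / (b + (\<delta> + sqrt (\<delta>\<^sup>2 + 8 * (1 / real (Suc k)))) / 2)) \<longlonglongrightarrow>
       expectation (\<lambda>\<omega>. exp (- 0 * argsup W \<omega> - b * overall_sup W \<omega>))"
      unfolding pos[OF inv_pos] .
    moreover have "(\<lambda>k. \<delta> / (b + (\<delta> + sqrt (\<delta>\<^sup>2 + 8 * (1 / real (Suc k)))) / 2)) \<longlonglongrightarrow>
       \<delta> / (b + (\<delta> + sqrt (\<delta>\<^sup>2 + 8 * 0)) / 2)"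
    proof (intro tendsto_intros)
      show "(\<lambda>k. 1 / real (Suc k)) \<longlonglongrightarrow> 0" by real_asymp
      show "b + (\<delta> + sqrt (\<delta>\<^sup>2 + 8 * 0)) / 2 \<noteq> 0" using assms \<delta>_pos by simp
    qed simp
    ultimately show ?thesis
      unfolding True by (rule LIMSEQ_unique)
  qed
qed

text \<open>
  Brownian scaling: time is measured in units of \<open>\<delta>\<close> to the power \<open>-2\<close> and space in units of \<open>1 / \<delta>\<close>.
\<close>

lemma laplace_scaled:
  assumes "0 \<le> t" "0 \<le> u"
  shows "expectation (\<lambda>\<omega>. exp (- t * (\<delta>\<^sup>2 * argsup W \<omega>) - u * (\<delta> * overall_sup W \<omega>))) =
    1 / (u + (1 + sqrt (1 + 8 * t)) / 2)"
proof -
  have "sqrt (\<delta>\<^sup>2 + 8 * (t * \<delta>\<^sup>2)) = sqrt (\<delta>\<^sup>2 * (1 + 8 * t))" by (simp add: algebra_simps)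
  also have "\<dots> = \<delta> * sqrt (1 + 8 * t)" using \<delta>_pos by (simp add: real_sqrt_mult)
  finally have "u * \<delta> + (\<delta> + sqrt (\<delta>\<^sup>2 + 8 * (t * \<delta>\<^sup>2))) / 2 = \<delta> * (u + (1 + sqrt (1 + 8 * t)) / 2)"
    by (simp add: algebra_simps add_divide_distrib)
  then show ?thesis
    using laplace_argsup_sup[of "t * \<delta>\<^sup>2" "u * \<delta>"] assms \<delta>_pos
    by (simp add: mult.assoc)
qed

end

section \<open>From Laplace transforms to moments\<close>

text \<open>
  Difference quotients of \<open>exp (- s x)\<close> at \<open>s = 0\<close>, negated. Their expectations are expressed by the Laplace
  transform, and along \<open>s = 1 / 2 ^ k\<close> they increase to \<open>x\<close>, so that monotone convergence yields
  integrability together with the value of the moment.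
\<close>

definition exp_quotient :: "nat \<Rightarrow> real \<Rightarrow> real" where
  "exp_quotient k x = (1 - exp (- ((1 / 2) ^ k) * x)) / (1 / 2) ^ k"

lemma exp_quotient_nonneg: "0 \<le> x \<Longrightarrow> 0 \<le> exp_quotient k x"
  by (simp add: exp_quotient_def)

text \<open>
  Halving \<open>s\<close> reduces to \<open>1 - u\<^sup>2 \<le> 2 (1 - u)\<close> for \<open>u = exp (- s x)\<close>.
\<close>

lemma exp_quotient_mono:
  assumes "0 \<le> x"
  shows "mono (\<lambda>k. exp_quotient k x)"
proof (rule incseq_SucI)
  fix k
  define s where "s = (1 / 2 :: real) ^ Suc k"
  define u where "u = exp (- s * x)"
  have s: "0 < s" by (simp add: s_def)
  have u: "0 < u" "u \<le> 1" using assms s by (simp_all add: u_def)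
  have half: "(1 / 2 :: real) ^ k = 2 * s" by (simp add: s_def)
  have "exp (- (2 * s) * x) = u * u" by (simp add: u_def exp_add[symmetric])
  then have "exp_quotient k x = (1 - u * u) / (2 * s)"
    unfolding exp_quotient_def half by simp
  also have "\<dots> \<le> (2 * (1 - u)) / (2 * s)"
  proof (rule divide_right_mono)
    have "0 \<le> (1 - u) * (1 - u)" by simp
    then show "1 - u * u \<le> 2 * (1 - u)" by (simp add: algebra_simps)
  qed (use s in simp)
  also have "\<dots> = exp_quotient (Suc k) x"
    unfolding exp_quotient_def s_def[symmetric] u_def by (subst mult_divide_mult_cancel_left) simp_all
  finally show "exp_quotient k x \<le> exp_quotient (Suc k) x" .
qed

lemma exp_quotient_tendsto: "(\<lambda>k. exp_quotient k x) \<longlonglongrightarrow> x"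
proof -
  have "((\<lambda>s. (1 - exp (- s * x)) / s) \<longlongrightarrow> x) (at_right 0)"
  proof -
    have "((\<lambda>s. 1 - exp (- s * x)) has_real_derivative x) (at 0)"
      by (auto intro!: derivative_eq_intros)
    then have "((\<lambda>s. (1 - exp (- s * x)) / s) \<longlongrightarrow> x) (at 0)"
      by (simp add: has_field_derivative_iff)
    then show ?thesis by (rule tendsto_within_subset) simp
  qed
  moreover have "filterlim (\<lambda>k. (1 / 2 :: real) ^ k) (at_right 0) sequentially"
    by real_asymp
  ultimately show ?thesis
    unfolding exp_quotient_def by (rule filterlim_compose)
qed

context prob_space
begin

lemma integrable_exp_neg:
  fixes X :: "'a \<Rightarrow> real"
  assumes [measurable]: "X \<in> borel_measurable M" and nonneg: "AE \<omega> in M. 0 \<le> X \<omega>" and "0 \<le> t"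
  shows "integrable M (\<lambda>\<omega>. exp (- t * X \<omega>))"
proof (rule integrable_const_bound[where B=1])
  show "AE \<omega> in M. norm (exp (- t * X \<omega>)) \<le> 1"
    using nonneg
  proof eventually_elim
    case (elim \<omega>)
    then have "0 \<le> t * X \<omega>" using \<open>0 \<le> t\<close> by simp
    then show ?case by simp
  qed
qed measurable

lemma
  fixes X :: "'a \<Rightarrow> real"
  assumes X: "X \<in> borel_measurable M" "AE \<omega> in M. 0 \<le> X \<omega>"
    and lim: "((\<lambda>t. (1 - expectation (\<lambda>\<omega>. exp (- t * X \<omega>))) / t) \<longlongrightarrow> c) (at_right 0)"
  shows integrable_of_laplace: "integrable M X"
    and expectation_of_laplace: "expectation X = c"
proof -
  note [measurable] = X(1)
  have int: "integrable M (\<lambda>\<omega>. exp (- t * X \<omega>))" if "0 \<le> t" for t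
    using X that by (rule integrable_exp_neg)
  have half: "filterlim (\<lambda>k. (1 / 2 :: real) ^ k) (at_right 0) sequentially"
    by real_asymp
  have trunc: "integrable M (\<lambda>\<omega>. exp_quotient k (X \<omega>))"
    "expectation (\<lambda>\<omega>. exp_quotient k (X \<omega>)) =
      (1 - expectation (\<lambda>\<omega>. exp (- ((1 / 2) ^ k) * X \<omega>))) / (1 / 2) ^ k" for k
    unfolding exp_quotient_def using int[of "(1 / 2) ^ k"] by (simp_all add: prob_space)
  have c: "(\<lambda>k. expectation (\<lambda>\<omega>. exp_quotient k (X \<omega>))) \<longlonglongrightarrow> c"
    unfolding trunc(2) by (rule filterlim_compose[OF lim half])
  have mono: "AE \<omega> in M. mono (\<lambda>k. exp_quotient k (X \<omega>))"
    using X(2) by eventually_elim (rule exp_quotient_mono)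
  have nonneg: "AE \<omega> in M. 0 \<le> exp_quotient k (X \<omega>)" for k
    using X(2) by eventually_elim (rule exp_quotient_nonneg)
  have tend: "AE \<omega> in M. (\<lambda>k. exp_quotient k (X \<omega>)) \<longlonglongrightarrow> X \<omega>"
    using exp_quotient_tendsto by simp
  show "integrable M X" "expectation X = c"
    using integral_monotone_convergence_nonneg[OF trunc(1) mono nonneg tend c X(1)] by auto
qed

lemma
  fixes X Y :: "'a \<Rightarrow> real"
  assumes X: "X \<in> borel_measurable M" "AE \<omega> in M. 0 \<le> X \<omega>"
    and Y: "Y \<in> borel_measurable M" "AE \<omega> in M. 0 \<le> Y \<omega>"
    and lim: "((\<lambda>t. (1 - expectation (\<lambda>\<omega>. exp (- t * X \<omega>)) - expectation (\<lambda>\<omega>. exp (- t * Y \<omega>))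
      + expectation (\<lambda>\<omega>. exp (- t * X \<omega> - t * Y \<omega>))) / t\<^sup>2) \<longlongrightarrow> c) (at_right 0)"
  shows integrable_product_of_laplace: "integrable M (\<lambda>\<omega>. X \<omega> * Y \<omega>)"
    and expectation_product_of_laplace: "expectation (\<lambda>\<omega>. X \<omega> * Y \<omega>) = c"
proof -
  note [measurable] = X(1) Y(1)
  have int_X: "integrable M (\<lambda>\<omega>. exp (- t * X \<omega>))" if "0 \<le> t" for t
    using X that by (rule integrable_exp_neg)
  have int_Y: "integrable M (\<lambda>\<omega>. exp (- t * Y \<omega>))" if "0 \<le> t" for t
    using Y that by (rule integrable_exp_neg)
  have int_XY: "integrable M (\<lambda>\<omega>. exp (- t * X \<omega> - t * Y \<omega>))" if "0 \<le> t" for t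
  proof (rule integrable_const_bound[where B=1])
    show "AE \<omega> in M. norm (exp (- t * X \<omega> - t * Y \<omega>)) \<le> 1"
      using X(2) Y(2)
    proof eventually_elim
      case (elim \<omega>)
      then have "0 \<le> t * X \<omega>" "0 \<le> t * Y \<omega>" using that by simp_all
      then show ?case by simp
    qed
  qed measurable
  have half: "filterlim (\<lambda>k. (1 / 2 :: real) ^ k) (at_right 0) sequentially"
    by real_asymp
  have expand: "exp_quotient k x * exp_quotient k y = (1 - exp (- ((1 / 2) ^ k) * x) - exp (- ((1 / 2) ^ k) * y)
      + exp (- ((1 / 2) ^ k) * x - ((1 / 2) ^ k) * y)) / ((1 / 2) ^ k)\<^sup>2" for k x y
  proof -
    have "exp (- ((1 / 2) ^ k) * x - ((1 / 2) ^ k) * y) = exp (- ((1 / 2) ^ k) * x) * exp (- ((1 / 2) ^ k) * y)"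
      by (simp add: exp_add[symmetric])
    then show ?thesis
      unfolding exp_quotient_def times_divide_times_eq power2_eq_square by (simp only:) (simp add: algebra_simps)
  qed
  have trunc: "integrable M (\<lambda>\<omega>. exp_quotient k (X \<omega>) * exp_quotient k (Y \<omega>))"
    "expectation (\<lambda>\<omega>. exp_quotient k (X \<omega>) * exp_quotient k (Y \<omega>)) =
      (1 - expectation (\<lambda>\<omega>. exp (- ((1 / 2) ^ k) * X \<omega>)) - expectation (\<lambda>\<omega>. exp (- ((1 / 2) ^ k) * Y \<omega>))
      + expectation (\<lambda>\<omega>. exp (- ((1 / 2) ^ k) * X \<omega> - ((1 / 2) ^ k) * Y \<omega>))) / ((1 / 2) ^ k)\<^sup>2" for k
    unfolding expand using int_X[of "(1 / 2) ^ k"] int_Y[of "(1 / 2) ^ k"] int_XY[of "(1 / 2) ^ k"]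
    by (simp_all add: prob_space)
  have c: "(\<lambda>k. expectation (\<lambda>\<omega>. exp_quotient k (X \<omega>) * exp_quotient k (Y \<omega>))) \<longlonglongrightarrow> c"
    unfolding trunc(2) by (rule filterlim_compose[OF lim half])
  have mono: "AE \<omega> in M. mono (\<lambda>k. exp_quotient k (X \<omega>) * exp_quotient k (Y \<omega>))"
    using X(2) Y(2)
  proof eventually_elim
    case (elim \<omega>)
    show ?case
      using exp_quotient_mono[OF elim(1)] exp_quotient_mono[OF elim(2)] exp_quotient_nonneg elim
      by (auto simp: mono_def intro!: mult_mono)
  qed
  have nonneg: "AE \<omega> in M. 0 \<le> exp_quotient k (X \<omega>) * exp_quotient k (Y \<omega>)" for k
    using X(2) Y(2) by eventually_elim (intro mult_nonneg_nonneg exp_quotient_nonneg)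
  have tend: "AE \<omega> in M. (\<lambda>k. exp_quotient k (X \<omega>) * exp_quotient k (Y \<omega>)) \<longlonglongrightarrow> X \<omega> * Y \<omega>"
    by (simp add: tendsto_mult exp_quotient_tendsto)
  have meas: "(\<lambda>\<omega>. X \<omega> * Y \<omega>) \<in> borel_measurable M" by measurable
  show "integrable M (\<lambda>\<omega>. X \<omega> * Y \<omega>)" "expectation (\<lambda>\<omega>. X \<omega> * Y \<omega>) = c"
    using integral_monotone_convergence_nonneg[OF trunc(1) mono nonneg tend c meas] by auto
qed

lemma covariance_eq:
  assumes "integrable M X" "integrable M Y" "integrable M (\<lambda>\<omega>. X \<omega> * Y \<omega>)"
  shows "covariance X Y = expectation (\<lambda>\<omega>. X \<omega> * Y \<omega>) - expectation X * expectation Y"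
proof -
  have "covariance X Y = expectation (\<lambda>\<omega>. X \<omega> * Y \<omega> - X \<omega> * expectation Y - expectation X * Y \<omega>
      + expectation X * expectation Y)"
    unfolding covariance_def by (intro Bochner_Integration.integral_cong) (simp_all add: algebra_simps)
  also have "\<dots> = expectation (\<lambda>\<omega>. X \<omega> * Y \<omega>) - expectation X * expectation Y"
    using assms by (simp add: prob_space)
  finally show ?thesis .
qed

lemma covariance_self: "covariance X X = variance X"
  by (simp add: covariance_def power2_eq_square)

lemma covariance_scale: "covariance (\<lambda>\<omega>. p * X \<omega>) (\<lambda>\<omega>. q * Y \<omega>) = p * q * covariance X Y"
proof -
  have "(p * X \<omega> - p * expectation X) * (q * Y \<omega> - q * expectation Y) =
      (p * q) * ((X \<omega> - expectation X) * (Y \<omega> - expectation Y))" for \<omega>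
    by (simp add: algebra_simps)
  then show ?thesis
    unfolding covariance_def by simp
qed

end

section \<open>The moments of the supremum and its location\<close>

theorem theorem3:
  fixes P :: "'a measure" and W :: "real \<Rightarrow> 'a \<Rightarrow> real" and \<delta> :: real
  assumes "\<delta> > 0"
    and "brownian_motion_with_drift P W (- \<delta> / 2)"
  shows "(prob_space.expectation P (argsup W) = 2 / \<delta> ^ 2 \<and>
          prob_space.variance P (argsup W) = 12 / \<delta> ^ 4) \<and>
         (prob_space.covariance P (argsup W) (overall_sup W) = 2 / \<delta> ^ 3 \<and>
          prob_space.correlation P (argsup W) (overall_sup W) = 1 / sqrt 3)"
proof -
  interpret negatively_drifted_brownian_motion P W \<delta>
    by (intro negatively_drifted_brownian_motion.intro assms
        negatively_drifted_brownian_motion_axioms.intro)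
  define X Y where "X \<omega> = \<delta>\<^sup>2 * argsup W \<omega>" and "Y \<omega> = \<delta> * overall_sup W \<omega>" for \<omega>
  have X: "X \<in> borel_measurable P" and Y: "Y \<in> borel_measurable P"
    unfolding X_def[abs_def] Y_def[abs_def] by measurable
  have X0: "AE \<omega> in P. 0 \<le> X \<omega>" and Y0: "AE \<omega> in P. 0 \<le> Y \<omega>"
    using AE_sup_nonneg by (eventually_elim, use assms(1) in \<open>simp add: X_def Y_def\<close>)+
  have joint: "expectation (\<lambda>\<omega>. exp (- t * X \<omega> - u * Y \<omega>)) = 1 / (u + (1 + sqrt (1 + 8 * t)) / 2)"
    if "0 \<le> t" "0 \<le> u" for t u
    unfolding X_def Y_def using that by (rule laplace_scaled)
  have lX: "expectation (\<lambda>\<omega>. exp (- t * X \<omega>)) = 2 / (1 + sqrt (1 + 8 * t))" if "0 \<le> t" for t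
    using joint[of t 0] that by simp
  have lY: "expectation (\<lambda>\<omega>. exp (- t * Y \<omega>)) = 1 / (t + 1)" if "0 \<le> t" for t
    using joint[of 0 t] that by simp
  have lXX: "expectation (\<lambda>\<omega>. exp (- t * X \<omega> - t * X \<omega>)) = 2 / (1 + sqrt (1 + 16 * t))" if "0 \<le> t" for t
    using lX[of "2 * t"] that by (simp add: algebra_simps)
  have lYY: "expectation (\<lambda>\<omega>. exp (- t * Y \<omega> - t * Y \<omega>)) = 1 / (2 * t + 1)" if "0 \<le> t" for t
    using lY[of "2 * t"] that by (simp add: algebra_simps)
  have t_pos: "\<forall>\<^sub>F t in at_right 0. (0::real) \<le> t"
    by real_asymp
  have limX: "((\<lambda>t. (1 - expectation (\<lambda>\<omega>. exp (- t * X \<omega>))) / t) \<longlongrightarrow> 2) (at_right 0)"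
  proof (rule Lim_transform_eventually)
    show "((\<lambda>t. (1 - 2 / (1 + sqrt (1 + 8 * t))) / t) \<longlongrightarrow> 2) (at_right (0::real))" by real_asymp
  qed (use t_pos in \<open>eventually_elim, simp only: lX\<close>)
  have limY: "((\<lambda>t. (1 - expectation (\<lambda>\<omega>. exp (- t * Y \<omega>))) / t) \<longlongrightarrow> 1) (at_right 0)"
  proof (rule Lim_transform_eventually)
    show "((\<lambda>t. (1 - 1 / (t + 1)) / t) \<longlongrightarrow> 1) (at_right (0::real))" by real_asymp
  qed (use t_pos in \<open>eventually_elim, simp only: lY\<close>)
  have limXX: "((\<lambda>t. (1 - expectation (\<lambda>\<omega>. exp (- t * X \<omega>)) - expectation (\<lambda>\<omega>. exp (- t * X \<omega>))
      + expectation (\<lambda>\<omega>. exp (- t * X \<omega> - t * X \<omega>))) / t\<^sup>2) \<longlongrightarrow> 16) (at_right 0)"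
  proof (rule Lim_transform_eventually)
    show "((\<lambda>t. (1 - 2 / (1 + sqrt (1 + 8 * t)) - 2 / (1 + sqrt (1 + 8 * t)) + 2 / (1 + sqrt (1 + 16 * t))) / t\<^sup>2)
      \<longlongrightarrow> 16) (at_right (0::real))" by real_asymp
  qed (use t_pos in \<open>eventually_elim, simp only: lX lXX\<close>)
  have limYY: "((\<lambda>t. (1 - expectation (\<lambda>\<omega>. exp (- t * Y \<omega>)) - expectation (\<lambda>\<omega>. exp (- t * Y \<omega>))
      + expectation (\<lambda>\<omega>. exp (- t * Y \<omega> - t * Y \<omega>))) / t\<^sup>2) \<longlongrightarrow> 2) (at_right 0)"
  proof (rule Lim_transform_eventually)
    show "((\<lambda>t. (1 - 1 / (t + 1) - 1 / (t + 1) + 1 / (2 * t + 1)) / t\<^sup>2) \<longlongrightarrow> 2) (at_right (0::real))"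
      by real_asymp
  qed (use t_pos in \<open>eventually_elim, simp only: lY lYY\<close>)
  have limXY: "((\<lambda>t. (1 - expectation (\<lambda>\<omega>. exp (- t * X \<omega>)) - expectation (\<lambda>\<omega>. exp (- t * Y \<omega>))
      + expectation (\<lambda>\<omega>. exp (- t * X \<omega> - t * Y \<omega>))) / t\<^sup>2) \<longlongrightarrow> 4) (at_right 0)"
  proof (rule Lim_transform_eventually)
    show "((\<lambda>t. (1 - 2 / (1 + sqrt (1 + 8 * t)) - 1 / (t + 1) + 1 / (t + (1 + sqrt (1 + 8 * t)) / 2)) / t\<^sup>2)
      \<longlongrightarrow> 4) (at_right (0::real))" by real_asymp
  qed (use t_pos in \<open>eventually_elim, simp only: lX lY joint\<close>)
  note intX = integrable_of_laplace[OF X X0 limX] and EX = expectation_of_laplace[OF X X0 limX]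
  note intY = integrable_of_laplace[OF Y Y0 limY] and EY = expectation_of_laplace[OF Y Y0 limY]
  have cov: "covariance X X = 12" "covariance Y Y = 1" "covariance X Y = 2"
    using covariance_eq[OF intX intX integrable_product_of_laplace[OF X X0 X X0 limXX]]
      covariance_eq[OF intY intY integrable_product_of_laplace[OF Y Y0 Y Y0 limYY]]
      covariance_eq[OF intX intY integrable_product_of_laplace[OF X X0 Y Y0 limXY]]
      expectation_product_of_laplace[OF X X0 X X0 limXX] expectation_product_of_laplace[OF Y Y0 Y Y0 limYY]
      expectation_product_of_laplace[OF X X0 Y Y0 limXY] EX EY by simp_all
  have argsup_X: "argsup W = (\<lambda>\<omega>. 1 / \<delta>\<^sup>2 * X \<omega>)" and sup_Y: "overall_sup W = (\<lambda>\<omega>. 1 / \<delta> * Y \<omega>)"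
    using assms(1) by (simp_all add: X_def Y_def fun_eq_iff)
  have E: "expectation (argsup W) = 2 / \<delta>\<^sup>2"
    unfolding argsup_X using EX by simp
  have V_argsup: "variance (argsup W) = 12 / \<delta> ^ 4"
    unfolding covariance_self[symmetric] unfolding argsup_X covariance_scale cov
    by (simp add: power2_eq_square power4_eq_xxxx)
  have V_sup: "variance (overall_sup W) = 1 / \<delta>\<^sup>2"
    unfolding covariance_self[symmetric] unfolding sup_Y covariance_scale cov
    by (simp add: power2_eq_square)
  have C: "covariance (argsup W) (overall_sup W) = 2 / \<delta> ^ 3"
    unfolding argsup_X sup_Y covariance_scale cov by (simp add: power2_eq_square power3_eq_cube)
  have "sqrt 12 = 2 * sqrt (3::real)"
    using real_sqrt_mult[of 4 3] by simp
  then have "sqrt (variance (argsup W)) * sqrt (variance (overall_sup W)) = 2 * sqrt 3 / \<delta> ^ 3"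
  proof -
    have "sqrt (\<delta> ^ 4) = \<delta>\<^sup>2" using assms(1) by (intro real_sqrt_unique) simp_all
    then show ?thesis
      unfolding V_argsup V_sup real_sqrt_divide \<open>sqrt 12 = _\<close>
      using assms(1) by (simp add: power2_eq_square power3_eq_cube)
  qed
  then have "correlation (argsup W) (overall_sup W) = 1 / sqrt 3"
    unfolding correlation_def C using assms(1) by simp
  with E V_argsup C show ?thesis by simp
qed

end
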